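(* Let $\mathcal{Q}$ be a small quantaloid and $\phi$ a $\mathcal{Q}$-distributor. If $\mathcal{K}\phi$ is $^{\mathrm{op}}$(ccd), then $\phi$ is regular.
   Context: A quantaloid is a category whose hom-sets are complete lattices and whose composition preserves arbitrary joins in each variable; it is small if it has a set of objects. For arrows $f:X\to Y$, $g:Y\to Z$, $h:X\to Z$ the residuals $h\swarrow f:Y\to Z$ and $g\searrow h:X\to Y$ are determined by $g\circ f\le h\iff g\le h\swarrow f\iff f\le g\searrow h$. A (small) $\mathcal{Q}$-category $\mathbb{A}$ consists of a set $\mathbb{A}_0$ of objects, a type map $t:\mathbb{A}_0\to\mathrm{ob}\,\mathcal{Q}$ and hom-arrows $\mathbb{A}(x,y)\in\mathcal{Q}(tx,ty)$ with $1_{tx}\le\mathbb{A}(x,x)$ and $\mathbb{A}(y,z)\circ\mathbb{A}(x,y)\le\mathbb{A}(x,z)$. Its underlying order: $x\le y$ iff $tx=ty$ and $1_{tx}\le\mathbb{A}(x,y)$. A $\mathcal{Q}$-functor $F:\mathbb{A}\to\mathbb{B}$ is a type-preserving map on objects with $\mathbb{A}(x,y)\le\mathbb{B}(Fx,Fy)$; $\mathcal{Q}$-functors are ordered pointwise by the underlying order, giving a 2-category $\mathcal{Q}\text{-}\mathbf{Cat}$ in which adjunctions are taken ($F\dashv G$ iff $1\le GF$ and $FG\le 1$). A $\mathcal{Q}$-distributor $\phi:\mathbb{A}\nrightarrow\mathbb{B}$ assigns to each $(x,y)\in\mathbb{A}_0\times\mathbb{B}_0$ an arrow $\phi(x,y)\in\mathcal{Q}(tx,ty)$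 with $\mathbb{B}(y,y')\circ\phi(x,y)\circ\mathbb{A}(x',x)\le\phi(x',y')$. With composition $(\psi\circ\phi)(x,z)=\bigvee_{y}\psi(y,z)\circ\phi(x,y)$, identities given by the hom-arrows, and pointwise order, $\mathcal{Q}$-categories and $\mathcal{Q}$-distributors form a quantaloid $\mathcal{Q}\text{-}\mathbf{Dist}$ (with residuals also denoted $\swarrow,\searrow$). $\phi:\mathbb{A}\nrightarrow\mathbb{B}$ is regular if there is $\psi:\mathbb{B}\nrightarrow\mathbb{A}$ with $\phi\circ\psi\circ\phi=\phi$. For $X\in\mathrm{ob}\,\mathcal{Q}$ let $\star_X$ be the $\mathcal{Q}$-category with a single object of type $X$ and hom-arrow $1_X$. The presheaf $\mathcal{Q}$-category $\mathcal{P}\mathbb{A}$ has as objects of type $X$ the $\mathcal{Q}$-distributors $\mu:\mathbb{A}\nrightarrow\star_X$, with $\mathcal{P}\mathbb{A}(\mu,\mu')=\mu'\swarrow\mu$. The copresheaf $\mathcal{Q}$-category $\mathcal{P}^{\dagger}\mathbb{A}$ has as objects of type $X$ the $\mathcal{Q}$-distributors $\lambda:\star_X\nrightarrow\mathbb{A}$, with $\mathcal{P}^{\dagger}\mathbb{A}(\lambda,\lambda')=\lambda'\searrow\lambda$. $\mathbb{A}$ is complete if the Yoneda embedding $\mathbb{A}\to\mathcal{P}\mathbb{A}$, $x\mapsto\mathbb{A}(-,x)$, has a left adjoint $\sup_{\mathbb{A}}$ in $\mathcal{Q}\text{-}\mathbf{Cat}$; equivalently, the co-Yoneda embedding $\mathbb{A}\to\mathcal{P}^{\dagger}\mathbb{A}$,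 $x\mapsto\mathbb{A}(x,-)$, has a right adjoint $\inf_{\mathbb{A}}:\mathcal{P}^{\dagger}\mathbb{A}\to\mathbb{A}$. $\mathbb{A}$ is $^{\mathrm{op}}$(ccd) (constructively completely codistributive) if it is complete and $\inf_{\mathbb{A}}$ has a right adjoint in $\mathcal{Q}\text{-}\mathbf{Cat}$. For $\phi:\mathbb{A}\nrightarrow\mathbb{B}$ let $\phi^*:\mathcal{P}\mathbb{B}\to\mathcal{P}\mathbb{A}$, $\lambda\mapsto\lambda\circ\phi$, and $\phi_*:\mathcal{P}\mathbb{A}\to\mathcal{P}\mathbb{B}$, $\mu\mapsto\mu\swarrow\phi$. $\mathcal{K}\phi:=\{\lambda\in\mathcal{P}\mathbb{B}\mid\phi_*\phi^*\lambda=\lambda\}$, regarded as a $\mathcal{Q}$-subcategory of $\mathcal{P}\mathbb{B}$. *)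

theory Defs
  imports "HOL-Algebra.Complete_Lattice"
begin

section \<open>Quantaloids\<close>

text \<open>
  Composition and identities carry the objects as arguments, so that the hom-sets need not be
  disjoint: \<open>qcomp Q X Y Z g f\<close> is the composite of \<open>f : X \<rightarrow> Y\<close> and \<open>g : Y \<rightarrow> Z\<close>.
  Smallness is built in, since \<open>qob Q\<close> is a set.
\<close>

record ('o, 'a) quantaloid_data =
  qob :: "'o set"
  qhom :: "'o \<Rightarrow> 'o \<Rightarrow> 'a gorder"
  qcomp :: "'o \<Rightarrow> 'o \<Rightarrow> 'o \<Rightarrow> 'a \<Rightarrow> 'a \<Rightarrow> 'a"
  qid :: "'o \<Rightarrow> 'a"

locale quantaloid =
  fixes Q :: "('o, 'a) quantaloid_data"
  assumes hom_complete_lattice: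
      "\<lbrakk>X \<in> qob Q; Y \<in> qob Q\<rbrakk> \<Longrightarrow> complete_lattice (qhom Q X Y)"
    and comp_closed:
      "\<lbrakk>X \<in> qob Q; Y \<in> qob Q; Z \<in> qob Q; f \<in> carrier (qhom Q X Y); g \<in> carrier (qhom Q Y Z)\<rbrakk>
        \<Longrightarrow> qcomp Q X Y Z g f \<in> carrier (qhom Q X Z)"
    and id_closed: "X \<in> qob Q \<Longrightarrow> qid Q X \<in> carrier (qhom Q X X)"
    and comp_assoc:
      "\<lbrakk>W \<in> qob Q; X \<in> qob Q; Y \<in> qob Q; Z \<in> qob Q;
        f \<in> carrier (qhom Q W X); g \<in> carrier (qhom Q X Y); h \<in> carrier (qhom Q Y Z)\<rbrakk>
        \<Longrightarrow> qcomp Q W Y Z h (qcomp Q W X Y g f) = qcomp Q W X Z (qcomp Q X Y Z h g) f"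
    and id_left:
      "\<lbrakk>X \<in> qob Q; Y \<in> qob Q; f \<in> carrier (qhom Q X Y)\<rbrakk> \<Longrightarrow> qcomp Q X Y Y (qid Q Y) f = f"
    and id_right:
      "\<lbrakk>X \<in> qob Q; Y \<in> qob Q; f \<in> carrier (qhom Q X Y)\<rbrakk> \<Longrightarrow> qcomp Q X X Y f (qid Q X) = f"
    and comp_Sup_left:
      "\<lbrakk>X \<in> qob Q; Y \<in> qob Q; Z \<in> qob Q; f \<in> carrier (qhom Q X Y); G \<subseteq> carrier (qhom Q Y Z)\<rbrakk>
        \<Longrightarrow> qcomp Q X Y Z (\<Squnion>\<^bsub>qhom Q Y Z\<^esub> G) f
            = \<Squnion>\<^bsub>qhom Q X Z\<^esub> ((\<lambda>g. qcomp Q X Y Z g f) ` G)"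
    and comp_Sup_right:
      "\<lbrakk>X \<in> qob Q; Y \<in> qob Q; Z \<in> qob Q; F \<subseteq> carrier (qhom Q X Y); g \<in> carrier (qhom Q Y Z)\<rbrakk>
        \<Longrightarrow> qcomp Q X Y Z g (\<Squnion>\<^bsub>qhom Q X Y\<^esub> F)
            = \<Squnion>\<^bsub>qhom Q X Z\<^esub> ((\<lambda>f. qcomp Q X Y Z g f) ` F)"

context quantaloid
begin

lemma hom_Sup_closed:
  assumes "X \<in> qob Q" "Y \<in> qob Q" "G \<subseteq> carrier (qhom Q X Y)"
  shows "\<Squnion>\<^bsub>qhom Q X Y\<^esub> G \<in> carrier (qhom Q X Y)"
proof -
  interpret complete_lattice "qhom Q X Y" using assms by (rule_tac hom_complete_lattice)
  show ?thesis using assms by simp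
qed

lemma hom_Sup_upper:
  assumes "X \<in> qob Q" "Y \<in> qob Q" "G \<subseteq> carrier (qhom Q X Y)" "g \<in> G"
  shows "g \<sqsubseteq>\<^bsub>qhom Q X Y\<^esub> \<Squnion>\<^bsub>qhom Q X Y\<^esub> G"
proof -
  interpret complete_lattice "qhom Q X Y" using assms by (rule_tac hom_complete_lattice)
  show ?thesis using assms by (simp add: sup_upper)
qed

lemma hom_Sup_least:
  assumes "X \<in> qob Q" "Y \<in> qob Q" "G \<subseteq> carrier (qhom Q X Y)" "h \<in> carrier (qhom Q X Y)"
    "\<And>g. g \<in> G \<Longrightarrow> g \<sqsubseteq>\<^bsub>qhom Q X Y\<^esub> h"
  shows "\<Squnion>\<^bsub>qhom Q X Y\<^esub> G \<sqsubseteq>\<^bsub>qhom Q X Y\<^esub> h"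
proof -
  interpret complete_lattice "qhom Q X Y" using assms by (rule_tac hom_complete_lattice)
  show ?thesis using assms by (simp add: sup_least)
qed

lemma hom_refl:
  assumes "X \<in> qob Q" "Y \<in> qob Q" "f \<in> carrier (qhom Q X Y)"
  shows "f \<sqsubseteq>\<^bsub>qhom Q X Y\<^esub> f"
proof -
  interpret complete_lattice "qhom Q X Y" using assms by (rule_tac hom_complete_lattice)
  show ?thesis using assms by simp
qed

lemma hom_trans:
  assumes "X \<in> qob Q" "Y \<in> qob Q" "f \<sqsubseteq>\<^bsub>qhom Q X Y\<^esub> g" "g \<sqsubseteq>\<^bsub>qhom Q X Y\<^esub> h"
    "f \<in> carrier (qhom Q X Y)" "g \<in> carrier (qhom Q X Y)" "h \<in> carrier (qhom Q X Y)"
  shows "f \<sqsubseteq>\<^bsub>qhom Q X Y\<^esub> h"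
proof -
  interpret complete_lattice "qhom Q X Y" using assms by (rule_tac hom_complete_lattice)
  show ?thesis using assms by (blast intro: le_trans)
qed

lemma hom_antisym:
  assumes "X \<in> qob Q" "Y \<in> qob Q" "f \<sqsubseteq>\<^bsub>qhom Q X Y\<^esub> g" "g \<sqsubseteq>\<^bsub>qhom Q X Y\<^esub> f"
    "f \<in> carrier (qhom Q X Y)" "g \<in> carrier (qhom Q X Y)"
  shows "f = g"
proof -
  interpret complete_lattice "qhom Q X Y" using assms by (rule_tac hom_complete_lattice)
  show ?thesis using assms by (blast intro: le_antisym)
qed

lemma hom_Sup_pair:
  assumes "X \<in> qob Q" "Y \<in> qob Q" "f \<sqsubseteq>\<^bsub>qhom Q X Y\<^esub> g"
    "f \<in> carrier (qhom Q X Y)" "g \<in> carrier (qhom Q X Y)"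
  shows "\<Squnion>\<^bsub>qhom Q X Y\<^esub> {f, g} = g"
proof (rule hom_antisym[OF assms(1,2)])
  show "\<Squnion>\<^bsub>qhom Q X Y\<^esub> {f, g} \<sqsubseteq>\<^bsub>qhom Q X Y\<^esub> g"
    using assms by (intro hom_Sup_least) (auto intro: hom_refl)
  show "g \<sqsubseteq>\<^bsub>qhom Q X Y\<^esub> \<Squnion>\<^bsub>qhom Q X Y\<^esub> {f, g}"
    using assms by (intro hom_Sup_upper) auto
  show "\<Squnion>\<^bsub>qhom Q X Y\<^esub> {f, g} \<in> carrier (qhom Q X Y)"
    using assms by (intro hom_Sup_closed) auto
qed fact

lemma comp_mono:
  assumes o: "X \<in> qob Q" "Y \<in> qob Q" "Z \<in> qob Q"
    and f: "f \<in> carrier (qhom Q X Y)" "f' \<in> carrier (qhom Q X Y)" "f \<sqsubseteq>\<^bsub>qhom Q X Y\<^esub> f'"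
    and g: "g \<in> carrier (qhom Q Y Z)" "g' \<in> carrier (qhom Q Y Z)" "g \<sqsubseteq>\<^bsub>qhom Q Y Z\<^esub> g'"
  shows "qcomp Q X Y Z g f \<sqsubseteq>\<^bsub>qhom Q X Z\<^esub> qcomp Q X Y Z g' f'"
proof (rule hom_trans)
  have "qcomp Q X Y Z g' f = \<Squnion>\<^bsub>qhom Q X Z\<^esub> {qcomp Q X Y Z g f, qcomp Q X Y Z g' f}"
    using comp_Sup_left[of X Y Z f "{g, g'}"] assms by (simp add: hom_Sup_pair)
  moreover have "qcomp Q X Y Z g f \<sqsubseteq>\<^bsub>qhom Q X Z\<^esub>
      \<Squnion>\<^bsub>qhom Q X Z\<^esub> {qcomp Q X Y Z g f, qcomp Q X Y Z g' f}"
    using assms by (intro hom_Sup_upper) (auto intro: comp_closed)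
  ultimately show "qcomp Q X Y Z g f \<sqsubseteq>\<^bsub>qhom Q X Z\<^esub> qcomp Q X Y Z g' f" by simp
  have "qcomp Q X Y Z g' f' = \<Squnion>\<^bsub>qhom Q X Z\<^esub> {qcomp Q X Y Z g' f, qcomp Q X Y Z g' f'}"
    using comp_Sup_right[of X Y Z "{f, f'}" g'] assms by (simp add: hom_Sup_pair)
  moreover have "qcomp Q X Y Z g' f \<sqsubseteq>\<^bsub>qhom Q X Z\<^esub>
      \<Squnion>\<^bsub>qhom Q X Z\<^esub> {qcomp Q X Y Z g' f, qcomp Q X Y Z g' f'}"
    using assms by (intro hom_Sup_upper) (auto intro: comp_closed)
  ultimately show "qcomp Q X Y Z g' f \<sqsubseteq>\<^bsub>qhom Q X Z\<^esub> qcomp Q X Y Z g' f'" by simp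
qed (use assms in \<open>auto intro: comp_closed\<close>)

end


section \<open>Categories and functors enriched in a quantaloid\<close>

record ('x, 'o, 'a) qcat =
  obs :: "'x set"
  tp :: "'x \<Rightarrow> 'o"
  arr :: "'x \<Rightarrow> 'x \<Rightarrow> 'a"

locale qcategory = quantaloid Q for Q :: "('o, 'a) quantaloid_data" +
  fixes A :: "('x, 'o, 'a) qcat"
  assumes tp_closed: "x \<in> obs A \<Longrightarrow> tp A x \<in> qob Q"
    and arr_closed:
      "\<lbrakk>x \<in> obs A; y \<in> obs A\<rbrakk> \<Longrightarrow> arr A x y \<in> carrier (qhom Q (tp A x) (tp A y))"
    and arr_id: "x \<in> obs A \<Longrightarrow> qid Q (tp A x) \<sqsubseteq>\<^bsub>qhom Q (tp A x) (tp A x)\<^esub> arr A x x"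
    and arr_comp:
      "\<lbrakk>x \<in> obs A; y \<in> obs A; z \<in> obs A\<rbrakk>
        \<Longrightarrow> qcomp Q (tp A x) (tp A y) (tp A z) (arr A y z) (arr A x y)
            \<sqsubseteq>\<^bsub>qhom Q (tp A x) (tp A z)\<^esub> arr A x z"

definition qcat_le ::
  "('o, 'a) quantaloid_data \<Rightarrow> ('x, 'o, 'a) qcat \<Rightarrow> 'x \<Rightarrow> 'x \<Rightarrow> bool" where
  "qcat_le Q A x y \<longleftrightarrow>
     tp A x = tp A y \<and> qid Q (tp A x) \<sqsubseteq>\<^bsub>qhom Q (tp A x) (tp A y)\<^esub> arr A x y"

definition qfunctor ::
  "('o, 'a) quantaloid_data \<Rightarrow> ('x, 'o, 'a) qcat \<Rightarrow> ('y, 'o, 'a) qcat \<Rightarrow> ('x \<Rightarrow> 'y) \<Rightarrow> bool" where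
  "qfunctor Q A B F \<longleftrightarrow>
     (\<forall>x\<in>obs A. F x \<in> obs B \<and> tp B (F x) = tp A x) \<and>
     (\<forall>x\<in>obs A. \<forall>y\<in>obs A. arr A x y \<sqsubseteq>\<^bsub>qhom Q (tp A x) (tp A y)\<^esub> arr B (F x) (F y))"

definition qadjoint ::
  "('o, 'a) quantaloid_data \<Rightarrow> ('x, 'o, 'a) qcat \<Rightarrow> ('y, 'o, 'a) qcat
    \<Rightarrow> ('x \<Rightarrow> 'y) \<Rightarrow> ('y \<Rightarrow> 'x) \<Rightarrow> bool" where
  "qadjoint Q A B F G \<longleftrightarrow>
     qfunctor Q A B F \<and> qfunctor Q B A G \<and>
     (\<forall>x\<in>obs A. qcat_le Q A x (G (F x))) \<and>
     (\<forall>y\<in>obs B. qcat_le Q B (F (G y)) y)"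


section \<open>Distributors\<close>

text \<open>
  The carrier of \<open>Dist Q A B\<close> consists of the distributors from \<open>A\<close> to \<open>B\<close>. They are extensional
  functions on \<open>obs A \<times> obs B\<close>, so that HOL equality is equality of distributors.
\<close>

definition Dist ::
  "('o, 'a) quantaloid_data \<Rightarrow> ('x, 'o, 'a) qcat \<Rightarrow> ('y, 'o, 'a) qcat
    \<Rightarrow> ('x \<times> 'y \<Rightarrow> 'a) gorder" where
  "Dist Q A B =
     \<lparr>carrier =
        {\<phi> \<in> (\<Pi>\<^sub>E (x, y) \<in> obs A \<times> obs B. carrier (qhom Q (tp A x) (tp B y))).
          \<forall>x\<in>obs A. \<forall>x'\<in>obs A. \<forall>y\<in>obs B. \<forall>y'\<in>obs B.
            qcomp Q (tp A x') (tp B y) (tp B y')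
              (arr B y y') (qcomp Q (tp A x') (tp A x) (tp B y) (\<phi> (x, y)) (arr A x' x))
            \<sqsubseteq>\<^bsub>qhom Q (tp A x') (tp B y')\<^esub> \<phi> (x', y')},
      eq = (=),
      le = (\<lambda>\<phi> \<psi>. \<forall>x\<in>obs A. \<forall>y\<in>obs B. \<phi> (x, y) \<sqsubseteq>\<^bsub>qhom Q (tp A x) (tp B y)\<^esub> \<psi> (x, y))\<rparr>"

definition dcomp ::
  "('o, 'a) quantaloid_data \<Rightarrow> ('x, 'o, 'a) qcat \<Rightarrow> ('y, 'o, 'a) qcat \<Rightarrow> ('z, 'o, 'a) qcat
    \<Rightarrow> ('y \<times> 'z \<Rightarrow> 'a) \<Rightarrow> ('x \<times> 'y \<Rightarrow> 'a) \<Rightarrow> ('x \<times> 'z \<Rightarrow> 'a)" where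
  "dcomp Q A B C \<psi> \<phi> =
     (\<lambda>(x, z) \<in> obs A \<times> obs C.
        \<Squnion>\<^bsub>qhom Q (tp A x) (tp C z)\<^esub>
          ((\<lambda>y. qcomp Q (tp A x) (tp B y) (tp C z) (\<psi> (y, z)) (\<phi> (x, y))) ` obs B))"

text \<open>
  The residuals of the quantaloid of distributors, given by their defining adjointness property:
  for \<open>\<phi>\<close> from \<open>A\<close> to \<open>B\<close>, \<open>\<psi>\<close> from \<open>B\<close> to \<open>C\<close> and \<open>\<chi>\<close> from \<open>A\<close> to \<open>C\<close>,
  \<open>res_sw Q A B C \<chi> \<phi>\<close> is \<open>\<chi> \<swarrow> \<phi>\<close> and \<open>res_se Q A B C \<psi> \<chi>\<close> is \<open>\<psi> \<searrow> \<chi>\<close>.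
  That they are well defined is shown in \<open>res_sw_adjoint\<close> and \<open>res_se_adjoint\<close> below.
\<close>

definition res_sw ::
  "('o, 'a) quantaloid_data \<Rightarrow> ('x, 'o, 'a) qcat \<Rightarrow> ('y, 'o, 'a) qcat \<Rightarrow> ('z, 'o, 'a) qcat
    \<Rightarrow> ('x \<times> 'z \<Rightarrow> 'a) \<Rightarrow> ('x \<times> 'y \<Rightarrow> 'a) \<Rightarrow> ('y \<times> 'z \<Rightarrow> 'a)" where
  "res_sw Q A B C \<chi> \<phi> =
     (THE \<rho>. \<rho> \<in> carrier (Dist Q B C) \<and>
        (\<forall>\<psi>\<in>carrier (Dist Q B C).
           dcomp Q A B C \<psi> \<phi> \<sqsubseteq>\<^bsub>Dist Q A C\<^esub> \<chi> \<longleftrightarrow> \<psi> \<sqsubseteq>\<^bsub>Dist Q B C\<^esub> \<rho>))"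

definition res_se ::
  "('o, 'a) quantaloid_data \<Rightarrow> ('x, 'o, 'a) qcat \<Rightarrow> ('y, 'o, 'a) qcat \<Rightarrow> ('z, 'o, 'a) qcat
    \<Rightarrow> ('y \<times> 'z \<Rightarrow> 'a) \<Rightarrow> ('x \<times> 'z \<Rightarrow> 'a) \<Rightarrow> ('x \<times> 'y \<Rightarrow> 'a)" where
  "res_se Q A B C \<psi> \<chi> =
     (THE \<rho>. \<rho> \<in> carrier (Dist Q A B) \<and>
        (\<forall>\<phi>\<in>carrier (Dist Q A B).
           dcomp Q A B C \<psi> \<phi> \<sqsubseteq>\<^bsub>Dist Q A C\<^esub> \<chi> \<longleftrightarrow> \<phi> \<sqsubseteq>\<^bsub>Dist Q A B\<^esub> \<rho>))"

lemma Dist_le: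
  "\<phi> \<sqsubseteq>\<^bsub>Dist Q A B\<^esub> \<psi> \<longleftrightarrow>
     (\<forall>x\<in>obs A. \<forall>y\<in>obs B. \<phi> (x, y) \<sqsubseteq>\<^bsub>qhom Q (tp A x) (tp B y)\<^esub> \<psi> (x, y))"
  by (simp add: Dist_def)

lemma Dist_value:
  "\<lbrakk>\<phi> \<in> carrier (Dist Q A B); x \<in> obs A; y \<in> obs B\<rbrakk>
    \<Longrightarrow> \<phi> (x, y) \<in> carrier (qhom Q (tp A x) (tp B y))"
  by (force simp: Dist_def PiE_def Pi_def)

lemma Dist_action:
  "\<lbrakk>\<phi> \<in> carrier (Dist Q A B); x \<in> obs A; x' \<in> obs A; y \<in> obs B; y' \<in> obs B\<rbrakk>
    \<Longrightarrow> qcomp Q (tp A x') (tp B y) (tp B y')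
          (arr B y y') (qcomp Q (tp A x') (tp A x) (tp B y) (\<phi> (x, y)) (arr A x' x))
        \<sqsubseteq>\<^bsub>qhom Q (tp A x') (tp B y')\<^esub> \<phi> (x', y')"
  by (simp add: Dist_def)

lemma DistI:
  assumes "\<phi> \<in> extensional (obs A \<times> obs B)"
    and "\<And>x y. \<lbrakk>x \<in> obs A; y \<in> obs B\<rbrakk> \<Longrightarrow> \<phi> (x, y) \<in> carrier (qhom Q (tp A x) (tp B y))"
    and "\<And>x x' y y'. \<lbrakk>x \<in> obs A; x' \<in> obs A; y \<in> obs B; y' \<in> obs B\<rbrakk>
      \<Longrightarrow> qcomp Q (tp A x') (tp B y) (tp B y')
          (arr B y y') (qcomp Q (tp A x') (tp A x) (tp B y) (\<phi> (x, y)) (arr A x' x))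
        \<sqsubseteq>\<^bsub>qhom Q (tp A x') (tp B y')\<^esub> \<phi> (x', y')"
  shows "\<phi> \<in> carrier (Dist Q A B)"
  using assms by (auto simp: Dist_def PiE_def)

lemma Dist_refl:
  assumes "quantaloid Q" "qcategory Q A" "qcategory Q B" "\<phi> \<in> carrier (Dist Q A B)"
  shows "\<phi> \<sqsubseteq>\<^bsub>Dist Q A B\<^esub> \<phi>"
  using assms Dist_value[OF assms(4)] unfolding Dist_le
  by (auto intro!: quantaloid.hom_refl qcategory.tp_closed)

lemma Dist_antisym:
  assumes "quantaloid Q" "qcategory Q A" "qcategory Q B"
    and "\<phi> \<in> carrier (Dist Q A B)" "\<psi> \<in> carrier (Dist Q A B)"
    and "\<phi> \<sqsubseteq>\<^bsub>Dist Q A B\<^esub> \<psi>" "\<psi> \<sqsubseteq>\<^bsub>Dist Q A B\<^esub> \<phi>"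
  shows "\<phi> = \<psi>"
proof (rule extensionalityI)
  show "\<phi> \<in> extensional (obs A \<times> obs B)" "\<psi> \<in> extensional (obs A \<times> obs B)"
    using assms by (auto simp: Dist_def PiE_def)
  fix p assume "p \<in> obs A \<times> obs B"
  then obtain x y where p: "p = (x, y)" "x \<in> obs A" "y \<in> obs B" by auto
  show "\<phi> p = \<psi> p"
    unfolding p(1) using assms p Dist_value[OF assms(4)] Dist_value[OF assms(5)]
    by (intro quantaloid.hom_antisym[of Q "tp A x" "tp B y"])
       (auto simp: Dist_le intro: qcategory.tp_closed)
qed

lemma dcomp_le_iff:
  assumes "quantaloid Q" "qcategory Q A" "qcategory Q B" "qcategory Q C"
    and \<psi>: "\<psi> \<in> carrier (Dist Q B C)" and \<phi>: "\<phi> \<in> carrier (Dist Q A B)"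
    and \<chi>: "\<chi> \<in> carrier (Dist Q A C)"
  shows "dcomp Q A B C \<psi> \<phi> \<sqsubseteq>\<^bsub>Dist Q A C\<^esub> \<chi> \<longleftrightarrow>
    (\<forall>x\<in>obs A. \<forall>y\<in>obs B. \<forall>z\<in>obs C.
       qcomp Q (tp A x) (tp B y) (tp C z) (\<psi> (y, z)) (\<phi> (x, y))
       \<sqsubseteq>\<^bsub>qhom Q (tp A x) (tp C z)\<^esub> \<chi> (x, z))" (is "?L \<longleftrightarrow> ?R")
proof -
  interpret quantaloid Q by fact
  interpret A: qcategory Q A by fact
  interpret B: qcategory Q B by fact
  interpret C: qcategory Q C by fact
  let ?c = "\<lambda>x y z. qcomp Q (tp A x) (tp B y) (tp C z) (\<psi> (y, z)) (\<phi> (x, y))"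
  have c: "?c x y z \<in> carrier (qhom Q (tp A x) (tp C z))"
    if "x \<in> obs A" "y \<in> obs B" "z \<in> obs C" for x y z
    using that Dist_value[OF \<psi>] Dist_value[OF \<phi>]
    by (auto intro!: comp_closed A.tp_closed B.tp_closed C.tp_closed)
  show ?thesis
  proof
    assume L: ?L
    show ?R
    proof (intro ballI)
      fix x y z assume o: "x \<in> obs A" "y \<in> obs B" "z \<in> obs C"
      have S: "(\<lambda>y. ?c x y z) ` obs B \<subseteq> carrier (qhom Q (tp A x) (tp C z))" using o c by auto
      have "?c x y z \<sqsubseteq>\<^bsub>qhom Q (tp A x) (tp C z)\<^esub> \<Squnion>\<^bsub>qhom Q (tp A x) (tp C z)\<^esub> ((\<lambda>y. ?c x y z) ` obs B)"
        using o S by (intro hom_Sup_upper A.tp_closed C.tp_closed) auto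
      moreover have "\<dots> \<sqsubseteq>\<^bsub>qhom Q (tp A x) (tp C z)\<^esub> \<chi> (x, z)"
        using L o by (simp add: Dist_le dcomp_def)
      ultimately show "?c x y z \<sqsubseteq>\<^bsub>qhom Q (tp A x) (tp C z)\<^esub> \<chi> (x, z)"
        by (rule hom_trans[rotated 2])
          (use o S c Dist_value[OF \<chi>] in
            \<open>auto intro!: hom_Sup_closed A.tp_closed C.tp_closed\<close>)
    qed
  next
    assume R: ?R
    show ?L
      unfolding Dist_le
    proof (intro ballI)
      fix x z assume o: "x \<in> obs A" "z \<in> obs C"
      then have "\<Squnion>\<^bsub>qhom Q (tp A x) (tp C z)\<^esub> ((\<lambda>y. ?c x y z) ` obs B)
          \<sqsubseteq>\<^bsub>qhom Q (tp A x) (tp C z)\<^esub> \<chi> (x, z)"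
        using R c Dist_value[OF \<chi>] by (intro hom_Sup_least A.tp_closed C.tp_closed) auto
      then show "dcomp Q A B C \<psi> \<phi> (x, z) \<sqsubseteq>\<^bsub>qhom Q (tp A x) (tp C z)\<^esub> \<chi> (x, z)"
        using o by (simp add: dcomp_def)
    qed
  qed
qed

lemma res_sw_adjoint:
  assumes "quantaloid Q" "qcategory Q A" "qcategory Q B" "qcategory Q C"
    and \<phi>: "\<phi> \<in> carrier (Dist Q A B)" and \<chi>: "\<chi> \<in> carrier (Dist Q A C)"
  shows "res_sw Q A B C \<chi> \<phi> \<in> carrier (Dist Q B C) \<and>
    (\<forall>\<psi>\<in>carrier (Dist Q B C).
      dcomp Q A B C \<psi> \<phi> \<sqsubseteq>\<^bsub>Dist Q A C\<^esub> \<chi> \<longleftrightarrow> \<psi> \<sqsubseteq>\<^bsub>Dist Q B C\<^esub> res_sw Q A B C \<chi> \<phi>)"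
proof -
  interpret quantaloid Q by fact
  interpret A: qcategory Q A by fact
  interpret B: qcategory Q B by fact
  interpret C: qcategory Q C by fact
  define S where "S = {\<psi> \<in> carrier (Dist Q B C). dcomp Q A B C \<psi> \<phi> \<sqsubseteq>\<^bsub>Dist Q A C\<^esub> \<chi>}"
  define H where "H y z = (\<lambda>\<psi>. \<psi> (y, z)) ` S" for y z
  define \<rho> where
    "\<rho> = (\<lambda>(y, z) \<in> obs B \<times> obs C. \<Squnion>\<^bsub>qhom Q (tp B y) (tp C z)\<^esub> (H y z))"
  have H: "H y z \<subseteq> carrier (qhom Q (tp B y) (tp C z))" if "y \<in> obs B" "z \<in> obs C" for y z
    using that by (auto simp: H_def S_def dest: Dist_value)
  have \<rho>_eq: "\<rho> (y, z) = \<Squnion>\<^bsub>qhom Q (tp B y) (tp C z)\<^esub> (H y z)"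
    if "y \<in> obs B" "z \<in> obs C" for y z
    using that by (simp add: \<rho>_def)
  have \<rho>_val: "\<rho> (y, z) \<in> carrier (qhom Q (tp B y) (tp C z))"
    if "y \<in> obs B" "z \<in> obs C" for y z
    unfolding \<rho>_eq[OF that] using that
    by (intro hom_Sup_closed H B.tp_closed C.tp_closed)
  have \<rho>_upper: "\<psi> \<sqsubseteq>\<^bsub>Dist Q B C\<^esub> \<rho>" if "\<psi> \<in> S" for \<psi>
    unfolding Dist_le
  proof (intro ballI)
    fix y z assume o: "y \<in> obs B" "z \<in> obs C"
    have "\<psi> (y, z) \<in> H y z" using that by (simp add: H_def)
    then show "\<psi> (y, z) \<sqsubseteq>\<^bsub>qhom Q (tp B y) (tp C z)\<^esub> \<rho> (y, z)"
      unfolding \<rho>_eq[OF o] using o by (intro hom_Sup_upper H B.tp_closed C.tp_closed)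
  qed
  have \<rho>_Dist: "\<rho> \<in> carrier (Dist Q B C)"
  proof (rule DistI)
    show "\<rho> \<in> extensional (obs B \<times> obs C)" by (simp add: \<rho>_def)
  next
    fix y z assume "y \<in> obs B" "z \<in> obs C"
    then show "\<rho> (y, z) \<in> carrier (qhom Q (tp B y) (tp C z))" by (rule \<rho>_val)
  next
    fix y y' z z' assume o: "y \<in> obs B" "y' \<in> obs B" "z \<in> obs C" "z' \<in> obs C"
    let ?k = "\<lambda>r. qcomp Q (tp B y') (tp C z) (tp C z') (arr C z z')
                 (qcomp Q (tp B y') (tp B y) (tp C z) r (arr B y' y))"
    have "?k (\<rho> (y, z)) = \<Squnion>\<^bsub>qhom Q (tp B y') (tp C z')\<^esub> (?k ` H y z)"
    proof -
      have "(\<lambda>r. qcomp Q (tp B y') (tp B y) (tp C z) r (arr B y' y)) ` H y z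
            \<subseteq> carrier (qhom Q (tp B y') (tp C z))"
        using H[of y z] o by (auto intro!: comp_closed B.tp_closed C.tp_closed B.arr_closed)
      then show ?thesis
        using o H[of y z] by (simp add: \<rho>_eq comp_Sup_left comp_Sup_right B.tp_closed
          C.tp_closed B.arr_closed C.arr_closed image_image)
    qed
    also have "\<dots> \<sqsubseteq>\<^bsub>qhom Q (tp B y') (tp C z')\<^esub> \<rho> (y', z')"
    proof (rule hom_Sup_least)
      show "tp B y' \<in> qob Q" "tp C z' \<in> qob Q" using o B.tp_closed C.tp_closed by auto
      show "?k ` H y z \<subseteq> carrier (qhom Q (tp B y') (tp C z'))"
        using H[of y z] o
        by (auto intro!: comp_closed B.tp_closed C.tp_closed B.arr_closed C.arr_closed)
      show "\<rho> (y', z') \<in> carrier (qhom Q (tp B y') (tp C z'))" using o \<rho>_val by blast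
      fix k assume "k \<in> ?k ` H y z"
      then obtain \<psi> where \<psi>: "\<psi> \<in> S" "k = ?k (\<psi> (y, z))" by (auto simp: H_def)
      then have D: "\<psi> \<in> carrier (Dist Q B C)" by (simp add: S_def)
      have "k \<sqsubseteq>\<^bsub>qhom Q (tp B y') (tp C z')\<^esub> \<psi> (y', z')"
        using Dist_action[OF D] o \<psi> by simp
      moreover have "\<psi> (y', z') \<sqsubseteq>\<^bsub>qhom Q (tp B y') (tp C z')\<^esub> \<rho> (y', z')"
        using \<rho>_upper[OF \<psi>(1)] o by (simp add: Dist_le)
      ultimately show "k \<sqsubseteq>\<^bsub>qhom Q (tp B y') (tp C z')\<^esub> \<rho> (y', z')"
        by (rule hom_trans[rotated 2])
          (use o \<psi> Dist_value[OF D] \<rho>_val in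
            \<open>auto intro!: comp_closed B.tp_closed C.tp_closed B.arr_closed C.arr_closed\<close>)
    qed
    finally show "?k (\<rho> (y, z)) \<sqsubseteq>\<^bsub>qhom Q (tp B y') (tp C z')\<^esub> \<rho> (y', z')" .
  qed
  have \<rho>_comp: "dcomp Q A B C \<rho> \<phi> \<sqsubseteq>\<^bsub>Dist Q A C\<^esub> \<chi>"
    unfolding dcomp_le_iff[OF assms(1-4) \<rho>_Dist \<phi> \<chi>]
  proof (intro ballI)
    fix x y z assume o: "x \<in> obs A" "y \<in> obs B" "z \<in> obs C"
    show "qcomp Q (tp A x) (tp B y) (tp C z) (\<rho> (y, z)) (\<phi> (x, y))
          \<sqsubseteq>\<^bsub>qhom Q (tp A x) (tp C z)\<^esub> \<chi> (x, z)"
      unfolding \<rho>_eq[OF o(2,3)]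
        comp_Sup_left[OF A.tp_closed[OF o(1)] B.tp_closed[OF o(2)] C.tp_closed[OF o(3)]
          Dist_value[OF \<phi> o(1,2)] H[OF o(2,3)]]
    proof (rule hom_Sup_least[OF A.tp_closed[OF o(1)] C.tp_closed[OF o(3)] _ Dist_value[OF \<chi> o(1,3)]])
      show "(\<lambda>g. qcomp Q (tp A x) (tp B y) (tp C z) g (\<phi> (x, y))) ` H y z \<subseteq> carrier (qhom Q (tp A x) (tp C z))"
        using H[OF o(2,3)] by (auto intro: comp_closed[OF A.tp_closed[OF o(1)] B.tp_closed[OF o(2)] C.tp_closed[OF o(3)] Dist_value[OF \<phi> o(1,2)]])
      fix k assume "k \<in> (\<lambda>g. qcomp Q (tp A x) (tp B y) (tp C z) g (\<phi> (x, y))) ` H y z"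
      then obtain \<psi> where "\<psi> \<in> S" and k: "k = qcomp Q (tp A x) (tp B y) (tp C z) (\<psi> (y, z)) (\<phi> (x, y))"
        by (auto simp: H_def)
      then have D: "\<psi> \<in> carrier (Dist Q B C)" and "dcomp Q A B C \<psi> \<phi> \<sqsubseteq>\<^bsub>Dist Q A C\<^esub> \<chi>"
        by (auto simp: S_def)
      then show "k \<sqsubseteq>\<^bsub>qhom Q (tp A x) (tp C z)\<^esub> \<chi> (x, z)"
        using o unfolding k dcomp_le_iff[OF assms(1-4) D \<phi> \<chi>] by blast
    qed
  qed
  have "\<rho> \<in> carrier (Dist Q B C) \<and> (\<forall>\<psi>\<in>carrier (Dist Q B C).
      dcomp Q A B C \<psi> \<phi> \<sqsubseteq>\<^bsub>Dist Q A C\<^esub> \<chi> \<longleftrightarrow> \<psi> \<sqsubseteq>\<^bsub>Dist Q B C\<^esub> \<rho>)" (is "?P \<rho>")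
  proof (intro conjI ballI iffI \<rho>_Dist)
    fix \<psi> assume D: "\<psi> \<in> carrier (Dist Q B C)"
    { assume "dcomp Q A B C \<psi> \<phi> \<sqsubseteq>\<^bsub>Dist Q A C\<^esub> \<chi>"
      with D show "\<psi> \<sqsubseteq>\<^bsub>Dist Q B C\<^esub> \<rho>" by (intro \<rho>_upper) (simp add: S_def) }
    assume le: "\<psi> \<sqsubseteq>\<^bsub>Dist Q B C\<^esub> \<rho>"
    show "dcomp Q A B C \<psi> \<phi> \<sqsubseteq>\<^bsub>Dist Q A C\<^esub> \<chi>"
      unfolding dcomp_le_iff[OF assms(1-4) D \<phi> \<chi>]
    proof (intro ballI)
      fix x y z assume o: "x \<in> obs A" "y \<in> obs B" "z \<in> obs C"
      show "qcomp Q (tp A x) (tp B y) (tp C z) (\<psi> (y, z)) (\<phi> (x, y))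
          \<sqsubseteq>\<^bsub>qhom Q (tp A x) (tp C z)\<^esub> \<chi> (x, z)"
      proof (rule hom_trans)
        show "qcomp Q (tp A x) (tp B y) (tp C z) (\<psi> (y, z)) (\<phi> (x, y))
          \<sqsubseteq>\<^bsub>qhom Q (tp A x) (tp C z)\<^esub> qcomp Q (tp A x) (tp B y) (tp C z) (\<rho> (y, z)) (\<phi> (x, y))"
          using o le Dist_value[OF D] Dist_value[OF \<phi>] \<rho>_val
          by (intro comp_mono) (auto simp: Dist_le intro: hom_refl A.tp_closed B.tp_closed C.tp_closed)
        show "qcomp Q (tp A x) (tp B y) (tp C z) (\<rho> (y, z)) (\<phi> (x, y))
          \<sqsubseteq>\<^bsub>qhom Q (tp A x) (tp C z)\<^esub> \<chi> (x, z)"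
          using \<rho>_comp o by (simp add: dcomp_le_iff[OF assms(1-4) \<rho>_Dist \<phi> \<chi>])
      qed (use o Dist_value[OF D] Dist_value[OF \<phi>] Dist_value[OF \<chi>] \<rho>_val in
           \<open>auto intro!: comp_closed A.tp_closed B.tp_closed C.tp_closed\<close>)
    qed
  qed
  moreover have "\<rho>' = \<rho>" if "?P \<rho>'" for \<rho>'
    using that \<open>?P \<rho>\<close> by (intro Dist_antisym[OF assms(1,3,4)]) (auto intro!: Dist_refl[OF assms(1,3,4)])
  ultimately show ?thesis
    unfolding res_sw_def by (rule theI[where P = ?P])
qed

lemma res_se_adjoint:
  assumes "quantaloid Q" "qcategory Q A" "qcategory Q B" "qcategory Q C"
    and \<psi>: "\<psi> \<in> carrier (Dist Q B C)" and \<chi>: "\<chi> \<in> carrier (Dist Q A C)"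
  shows "res_se Q A B C \<psi> \<chi> \<in> carrier (Dist Q A B) \<and>
    (\<forall>\<phi>\<in>carrier (Dist Q A B).
      dcomp Q A B C \<psi> \<phi> \<sqsubseteq>\<^bsub>Dist Q A C\<^esub> \<chi> \<longleftrightarrow> \<phi> \<sqsubseteq>\<^bsub>Dist Q A B\<^esub> res_se Q A B C \<psi> \<chi>)"
proof -
  interpret quantaloid Q by fact
  interpret A: qcategory Q A by fact
  interpret B: qcategory Q B by fact
  interpret C: qcategory Q C by fact
  define S where "S = {\<phi> \<in> carrier (Dist Q A B). dcomp Q A B C \<psi> \<phi> \<sqsubseteq>\<^bsub>Dist Q A C\<^esub> \<chi>}"
  define H where "H x y = (\<lambda>\<phi>. \<phi> (x, y)) ` S" for x y
  define \<rho> where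
    "\<rho> = (\<lambda>(x, y) \<in> obs A \<times> obs B. \<Squnion>\<^bsub>qhom Q (tp A x) (tp B y)\<^esub> (H x y))"
  have H: "H x y \<subseteq> carrier (qhom Q (tp A x) (tp B y))" if "x \<in> obs A" "y \<in> obs B" for x y
    using that by (auto simp: H_def S_def dest: Dist_value)
  have \<rho>_eq: "\<rho> (x, y) = \<Squnion>\<^bsub>qhom Q (tp A x) (tp B y)\<^esub> (H x y)"
    if "x \<in> obs A" "y \<in> obs B" for x y
    using that by (simp add: \<rho>_def)
  have \<rho>_val: "\<rho> (x, y) \<in> carrier (qhom Q (tp A x) (tp B y))"
    if "x \<in> obs A" "y \<in> obs B" for x y
    unfolding \<rho>_eq[OF that] using that
    by (intro hom_Sup_closed H A.tp_closed B.tp_closed)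
  have \<rho>_upper: "\<phi> \<sqsubseteq>\<^bsub>Dist Q A B\<^esub> \<rho>" if "\<phi> \<in> S" for \<phi>
    unfolding Dist_le
  proof (intro ballI)
    fix x y assume o: "x \<in> obs A" "y \<in> obs B"
    have "\<phi> (x, y) \<in> H x y" using that by (simp add: H_def)
    then show "\<phi> (x, y) \<sqsubseteq>\<^bsub>qhom Q (tp A x) (tp B y)\<^esub> \<rho> (x, y)"
      unfolding \<rho>_eq[OF o] using o by (intro hom_Sup_upper H A.tp_closed B.tp_closed)
  qed
  have \<rho>_Dist: "\<rho> \<in> carrier (Dist Q A B)"
  proof (rule DistI)
    show "\<rho> \<in> extensional (obs A \<times> obs B)" by (simp add: \<rho>_def)
  next
    fix x y assume "x \<in> obs A" "y \<in> obs B"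
    then show "\<rho> (x, y) \<in> carrier (qhom Q (tp A x) (tp B y))" by (rule \<rho>_val)
  next
    fix x x' y y' assume o: "x \<in> obs A" "x' \<in> obs A" "y \<in> obs B" "y' \<in> obs B"
    let ?k = "\<lambda>r. qcomp Q (tp A x') (tp B y) (tp B y') (arr B y y')
                 (qcomp Q (tp A x') (tp A x) (tp B y) r (arr A x' x))"
    have "?k (\<rho> (x, y)) = \<Squnion>\<^bsub>qhom Q (tp A x') (tp B y')\<^esub> (?k ` H x y)"
    proof -
      have "(\<lambda>r. qcomp Q (tp A x') (tp A x) (tp B y) r (arr A x' x)) ` H x y
            \<subseteq> carrier (qhom Q (tp A x') (tp B y))"
        using H[of x y] o by (auto intro!: comp_closed A.tp_closed B.tp_closed A.arr_closed)
      then show ?thesis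
        using o H[of x y] by (simp add: \<rho>_eq comp_Sup_left comp_Sup_right A.tp_closed
          B.tp_closed A.arr_closed B.arr_closed image_image)
    qed
    also have "\<dots> \<sqsubseteq>\<^bsub>qhom Q (tp A x') (tp B y')\<^esub> \<rho> (x', y')"
    proof (rule hom_Sup_least)
      show "tp A x' \<in> qob Q" "tp B y' \<in> qob Q" using o A.tp_closed B.tp_closed by auto
      show "?k ` H x y \<subseteq> carrier (qhom Q (tp A x') (tp B y'))"
        using H[of x y] o
        by (auto intro!: comp_closed A.tp_closed B.tp_closed A.arr_closed B.arr_closed)
      show "\<rho> (x', y') \<in> carrier (qhom Q (tp A x') (tp B y'))" using o \<rho>_val by blast
      fix k assume "k \<in> ?k ` H x y"
      then obtain \<phi> where \<phi>: "\<phi> \<in> S" "k = ?k (\<phi> (x, y))" by (auto simp: H_def)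
      then have D: "\<phi> \<in> carrier (Dist Q A B)" by (simp add: S_def)
      have "k \<sqsubseteq>\<^bsub>qhom Q (tp A x') (tp B y')\<^esub> \<phi> (x', y')"
        using Dist_action[OF D] o \<phi> by simp
      moreover have "\<phi> (x', y') \<sqsubseteq>\<^bsub>qhom Q (tp A x') (tp B y')\<^esub> \<rho> (x', y')"
        using \<rho>_upper[OF \<phi>(1)] o by (simp add: Dist_le)
      ultimately show "k \<sqsubseteq>\<^bsub>qhom Q (tp A x') (tp B y')\<^esub> \<rho> (x', y')"
        by (rule hom_trans[rotated 2])
          (use o \<phi> Dist_value[OF D] \<rho>_val in
            \<open>auto intro!: comp_closed A.tp_closed B.tp_closed A.arr_closed B.arr_closed\<close>)
    qed
    finally show "?k (\<rho> (x, y)) \<sqsubseteq>\<^bsub>qhom Q (tp A x') (tp B y')\<^esub> \<rho> (x', y')" .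
  qed
  have \<rho>_comp: "dcomp Q A B C \<psi> \<rho> \<sqsubseteq>\<^bsub>Dist Q A C\<^esub> \<chi>"
    unfolding dcomp_le_iff[OF assms(1-4) \<psi> \<rho>_Dist \<chi>]
  proof (intro ballI)
    fix x y z assume o: "x \<in> obs A" "y \<in> obs B" "z \<in> obs C"
    show "qcomp Q (tp A x) (tp B y) (tp C z) (\<psi> (y, z)) (\<rho> (x, y))
          \<sqsubseteq>\<^bsub>qhom Q (tp A x) (tp C z)\<^esub> \<chi> (x, z)"
      unfolding \<rho>_eq[OF o(1,2)]
        comp_Sup_right[OF A.tp_closed[OF o(1)] B.tp_closed[OF o(2)] C.tp_closed[OF o(3)]
          H[OF o(1,2)] Dist_value[OF \<psi> o(2,3)]]
    proof (rule hom_Sup_least[OF A.tp_closed[OF o(1)] C.tp_closed[OF o(3)] _ Dist_value[OF \<chi> o(1,3)]])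
      show "(\<lambda>g. qcomp Q (tp A x) (tp B y) (tp C z) (\<psi> (y, z)) g) ` H x y \<subseteq> carrier (qhom Q (tp A x) (tp C z))"
        using H[OF o(1,2)] by (auto intro: comp_closed[OF A.tp_closed[OF o(1)] B.tp_closed[OF o(2)] C.tp_closed[OF o(3)] _ Dist_value[OF \<psi> o(2,3)]])
      fix k assume "k \<in> (\<lambda>g. qcomp Q (tp A x) (tp B y) (tp C z) (\<psi> (y, z)) g) ` H x y"
      then obtain \<phi> where "\<phi> \<in> S" and k: "k = qcomp Q (tp A x) (tp B y) (tp C z) (\<psi> (y, z)) (\<phi> (x, y))"
        by (auto simp: H_def)
      then have D: "\<phi> \<in> carrier (Dist Q A B)" and "dcomp Q A B C \<psi> \<phi> \<sqsubseteq>\<^bsub>Dist Q A C\<^esub> \<chi>"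
        by (auto simp: S_def)
      then show "k \<sqsubseteq>\<^bsub>qhom Q (tp A x) (tp C z)\<^esub> \<chi> (x, z)"
        using o unfolding k dcomp_le_iff[OF assms(1-4) \<psi> D \<chi>] by blast
    qed
  qed
  have "\<rho> \<in> carrier (Dist Q A B) \<and> (\<forall>\<phi>\<in>carrier (Dist Q A B).
      dcomp Q A B C \<psi> \<phi> \<sqsubseteq>\<^bsub>Dist Q A C\<^esub> \<chi> \<longleftrightarrow> \<phi> \<sqsubseteq>\<^bsub>Dist Q A B\<^esub> \<rho>)" (is "?P \<rho>")
  proof (intro conjI ballI iffI \<rho>_Dist)
    fix \<phi> assume D: "\<phi> \<in> carrier (Dist Q A B)"
    { assume "dcomp Q A B C \<psi> \<phi> \<sqsubseteq>\<^bsub>Dist Q A C\<^esub> \<chi>"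
      with D show "\<phi> \<sqsubseteq>\<^bsub>Dist Q A B\<^esub> \<rho>" by (intro \<rho>_upper) (simp add: S_def) }
    assume le: "\<phi> \<sqsubseteq>\<^bsub>Dist Q A B\<^esub> \<rho>"
    show "dcomp Q A B C \<psi> \<phi> \<sqsubseteq>\<^bsub>Dist Q A C\<^esub> \<chi>"
      unfolding dcomp_le_iff[OF assms(1-4) \<psi> D \<chi>]
    proof (intro ballI)
      fix x y z assume o: "x \<in> obs A" "y \<in> obs B" "z \<in> obs C"
      show "qcomp Q (tp A x) (tp B y) (tp C z) (\<psi> (y, z)) (\<phi> (x, y))
          \<sqsubseteq>\<^bsub>qhom Q (tp A x) (tp C z)\<^esub> \<chi> (x, z)"
      proof (rule hom_trans)
        show "qcomp Q (tp A x) (tp B y) (tp C z) (\<psi> (y, z)) (\<phi> (x, y))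
          \<sqsubseteq>\<^bsub>qhom Q (tp A x) (tp C z)\<^esub> qcomp Q (tp A x) (tp B y) (tp C z) (\<psi> (y, z)) (\<rho> (x, y))"
          using o le Dist_value[OF D] Dist_value[OF \<psi>] \<rho>_val
          by (intro comp_mono) (auto simp: Dist_le intro: hom_refl A.tp_closed B.tp_closed C.tp_closed)
        show "qcomp Q (tp A x) (tp B y) (tp C z) (\<psi> (y, z)) (\<rho> (x, y))
          \<sqsubseteq>\<^bsub>qhom Q (tp A x) (tp C z)\<^esub> \<chi> (x, z)"
          using \<rho>_comp o by (simp add: dcomp_le_iff[OF assms(1-4) \<psi> \<rho>_Dist \<chi>])
      qed (use o Dist_value[OF D] Dist_value[OF \<psi>] Dist_value[OF \<chi>] \<rho>_val in
           \<open>auto intro!: comp_closed A.tp_closed B.tp_closed C.tp_closed\<close>)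
    qed
  qed
  moreover have "\<rho>' = \<rho>" if "?P \<rho>'" for \<rho>'
    using that \<open>?P \<rho>\<close> by (intro Dist_antisym[OF assms(1,2,3)]) (auto intro!: Dist_refl[OF assms(1,2,3)])
  ultimately show ?thesis
    unfolding res_se_def by (rule theI[where P = ?P])
qed

definition regular_dist ::
  "('o, 'a) quantaloid_data \<Rightarrow> ('x, 'o, 'a) qcat \<Rightarrow> ('y, 'o, 'a) qcat
    \<Rightarrow> ('x \<times> 'y \<Rightarrow> 'a) \<Rightarrow> bool" where
  "regular_dist Q A B \<phi> \<longleftrightarrow>
     (\<exists>\<psi>\<in>carrier (Dist Q B A). dcomp Q A A B \<phi> (dcomp Q A B A \<psi> \<phi>) = \<phi>)"


section \<open>Presheaves and copresheaves\<close>

definition star :: "('o, 'a) quantaloid_data \<Rightarrow> 'o \<Rightarrow> (unit, 'o, 'a) qcat" where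
  "star Q X = \<lparr>obs = {()}, tp = (\<lambda>_. X), arr = (\<lambda>_ _. qid Q X)\<rparr>"

text \<open>
  A (co)presheaf is paired with its type, because one function may be a distributor to (or from)
  \<open>star Q X\<close> for several \<open>X\<close>. A distributor from \<open>star Q X\<close> to \<open>star Q Y\<close> is identified with the
  arrow \<open>X \<rightarrow> Y\<close> which is its value at \<open>((), ())\<close>.
\<close>

definition presheaf_cat ::
  "('o, 'a) quantaloid_data \<Rightarrow> ('x, 'o, 'a) qcat \<Rightarrow> ('o \<times> ('x \<times> unit \<Rightarrow> 'a), 'o, 'a) qcat" where
  "presheaf_cat Q A =
     \<lparr>obs = (SIGMA X : qob Q. carrier (Dist Q A (star Q X))),
      tp = fst,
      arr = (\<lambda>(X, \<mu>) (X', \<mu>'). res_sw Q A (star Q X) (star Q X') \<mu>' \<mu> ((), ()))\<rparr>"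

definition copresheaf_cat ::
  "('o, 'a) quantaloid_data \<Rightarrow> ('x, 'o, 'a) qcat \<Rightarrow> ('o \<times> (unit \<times> 'x \<Rightarrow> 'a), 'o, 'a) qcat" where
  "copresheaf_cat Q A =
     \<lparr>obs = (SIGMA X : qob Q. carrier (Dist Q (star Q X) A)),
      tp = fst,
      arr = (\<lambda>(X, \<mu>) (X', \<mu>'). res_se Q (star Q X) (star Q X') A \<mu>' \<mu> ((), ()))\<rparr>"

definition yoneda :: "('x, 'o, 'a) qcat \<Rightarrow> 'x \<Rightarrow> 'o \<times> ('x \<times> unit \<Rightarrow> 'a)" where
  "yoneda A x = (tp A x, \<lambda>(y, _) \<in> obs A \<times> {()}. arr A y x)"

definition coyoneda :: "('x, 'o, 'a) qcat \<Rightarrow> 'x \<Rightarrow> 'o \<times> (unit \<times> 'x \<Rightarrow> 'a)" where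
  "coyoneda A x = (tp A x, \<lambda>(_, y) \<in> {()} \<times> obs A. arr A x y)"

definition complete_qcat :: "('o, 'a) quantaloid_data \<Rightarrow> ('x, 'o, 'a) qcat \<Rightarrow> bool" where
  "complete_qcat Q A \<longleftrightarrow> (\<exists>S. qadjoint Q (presheaf_cat Q A) A S (yoneda A))"

text \<open>
  The functor \<open>I\<close> is \<open>inf\<close>; it is determined up to isomorphism, so the existence of a right
  adjoint does not depend on the choice of \<open>I\<close>.
\<close>

definition op_ccd :: "('o, 'a) quantaloid_data \<Rightarrow> ('x, 'o, 'a) qcat \<Rightarrow> bool" where
  "op_ccd Q A \<longleftrightarrow>
     complete_qcat Q A \<and>
     (\<exists>I. qadjoint Q A (copresheaf_cat Q A) (coyoneda A) I \<and>
          (\<exists>R. qadjoint Q (copresheaf_cat Q A) A I R))"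


section \<open>The category of fixed points of a distributor\<close>

definition upper_star ::
  "('o, 'a) quantaloid_data \<Rightarrow> ('x, 'o, 'a) qcat \<Rightarrow> ('y, 'o, 'a) qcat \<Rightarrow> ('x \<times> 'y \<Rightarrow> 'a)
    \<Rightarrow> 'o \<times> ('y \<times> unit \<Rightarrow> 'a) \<Rightarrow> 'o \<times> ('x \<times> unit \<Rightarrow> 'a)" where
  "upper_star Q A B \<phi> = (\<lambda>(X, \<mu>). (X, dcomp Q A B (star Q X) \<mu> \<phi>))"

definition lower_star ::
  "('o, 'a) quantaloid_data \<Rightarrow> ('x, 'o, 'a) qcat \<Rightarrow> ('y, 'o, 'a) qcat \<Rightarrow> ('x \<times> 'y \<Rightarrow> 'a)
    \<Rightarrow> 'o \<times> ('x \<times> unit \<Rightarrow> 'a) \<Rightarrow> 'o \<times> ('y \<times> unit \<Rightarrow> 'a)" where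
  "lower_star Q A B \<phi> = (\<lambda>(X, \<mu>). (X, res_sw Q A B (star Q X) \<mu> \<phi>))"

definition K_cat ::
  "('o, 'a) quantaloid_data \<Rightarrow> ('x, 'o, 'a) qcat \<Rightarrow> ('y, 'o, 'a) qcat \<Rightarrow> ('x \<times> 'y \<Rightarrow> 'a)
    \<Rightarrow> ('o \<times> ('y \<times> unit \<Rightarrow> 'a), 'o, 'a) qcat" where
  "K_cat Q A B \<phi> =
     (presheaf_cat Q B)
       \<lparr>obs := {l \<in> obs (presheaf_cat Q B). lower_star Q A B \<phi> (upper_star Q A B \<phi> l) = l}\<rparr>"

end

(*
  Write K for the category of fixed points, and for an object x of A let ev_x be the copresheaf
  on K with ev_x(w) = (w o phi)(x). The candidate quasi-inverse is psi(y,x) = (inf ev_x)(y), that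
  is, the largest arrow d with (w o phi)(x) o d <= w(y) for all w in K.

  Taking for w the closure of the representable presheaf of y gives phi o psi o phi <= phi.

  For the converse, fix x and y, put f = (phi o psi o phi)(x,y), and let m in K be the presheaf
  b |-> (the largest d with d o phi(x,b) <= f). By choice of f, phi(a,y) <= K(inf ev_a, m) for every
  a in A. If R is right adjoint to inf, the right-hand side is (R m) \<searrow> ev_a computed in
  the copresheaves, so (R m)(w) o phi(a,y) <= (w o phi)(a) for all a and w; as w is a fixed point,
  (R m)(w) <= w(y) for all w. Hence 1 <= (inf R m)(y) <= m(y), which says phi(x,y) <= f.
*)

theory Submission
  imports Defs
begin

section \<open>Pointwise calculus of distributors\<close>

declare (in quantaloid) comp_closed [simp] id_closed [simp] id_left [simp] id_right [simp]
declare (in qcategory) tp_closed [simp] arr_closed [simp]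

section \<open>Monotonicity of composition, combined with transitivity\<close>

context quantaloid
begin

lemma comp_mono_left:
  assumes "X \<in> qob Q" "Y \<in> qob Q" "Z \<in> qob Q" "f \<in> carrier (qhom Q X Y)"
    and "g \<in> carrier (qhom Q Y Z)" "g' \<in> carrier (qhom Q Y Z)" "g \<sqsubseteq>\<^bsub>qhom Q Y Z\<^esub> g'"
  shows "qcomp Q X Y Z g f \<sqsubseteq>\<^bsub>qhom Q X Z\<^esub> qcomp Q X Y Z g' f"
  using assms by (intro comp_mono hom_refl) auto

lemma comp_mono_right:
  assumes "X \<in> qob Q" "Y \<in> qob Q" "Z \<in> qob Q" "g \<in> carrier (qhom Q Y Z)"
    and "f \<in> carrier (qhom Q X Y)" "f' \<in> carrier (qhom Q X Y)" "f \<sqsubseteq>\<^bsub>qhom Q X Y\<^esub> f'"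
  shows "qcomp Q X Y Z g f \<sqsubseteq>\<^bsub>qhom Q X Z\<^esub> qcomp Q X Y Z g f'"
  using assms by (intro comp_mono hom_refl) auto

text \<open>Monotonicity merged with transitivity: to bound a composite it suffices to bound it
  after one factor has been enlarged. The inequality chains below are built mainly from this rule
  and its mirror image.\<close>

lemma comp_le_trans_left:
  assumes "X \<in> qob Q" "Y \<in> qob Q" "Z \<in> qob Q" "f \<in> carrier (qhom Q X Y)"
    and "g \<in> carrier (qhom Q Y Z)" "g' \<in> carrier (qhom Q Y Z)" "h \<in> carrier (qhom Q X Z)"
    and "g \<sqsubseteq>\<^bsub>qhom Q Y Z\<^esub> g'" "qcomp Q X Y Z g' f \<sqsubseteq>\<^bsub>qhom Q X Z\<^esub> h"
  shows "qcomp Q X Y Z g f \<sqsubseteq>\<^bsub>qhom Q X Z\<^esub> h"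
  using assms by (intro hom_trans[OF _ _ comp_mono_left[of X Y Z f g g']]) auto

lemma comp_le_trans_right:
  assumes "X \<in> qob Q" "Y \<in> qob Q" "Z \<in> qob Q" "g \<in> carrier (qhom Q Y Z)"
    and "f \<in> carrier (qhom Q X Y)" "f' \<in> carrier (qhom Q X Y)" "h \<in> carrier (qhom Q X Z)"
    and "f \<sqsubseteq>\<^bsub>qhom Q X Y\<^esub> f'" "qcomp Q X Y Z g f' \<sqsubseteq>\<^bsub>qhom Q X Z\<^esub> h"
  shows "qcomp Q X Y Z g f \<sqsubseteq>\<^bsub>qhom Q X Z\<^esub> h"
  using assms by (intro hom_trans[OF _ _ comp_mono_right[of X Y Z g f f']]) auto

lemma star_simps [simp]:
  "obs (star Q X) = {()}" "tp (star Q X) u = X" "arr (star Q X) u v = qid Q X"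
  by (simp_all add: star_def)

lemma qcategory_star [simp]:
  assumes "X \<in> qob Q"
  shows "qcategory Q (star Q X)"
  using assms by unfold_locales (auto intro: hom_refl)

end

section \<open>One-sided actions on distributors\<close>

lemma Dist_post:
  assumes "qcategory Q A" "qcategory Q B" and \<phi>: "\<phi> \<in> carrier (Dist Q A B)"
    and o: "x \<in> obs A" "y \<in> obs B" "y' \<in> obs B"
  shows "qcomp Q (tp A x) (tp B y) (tp B y') (arr B y y') (\<phi> (x, y))
    \<sqsubseteq>\<^bsub>qhom Q (tp A x) (tp B y')\<^esub> \<phi> (x, y')"
proof -
  interpret A: qcategory Q A by fact
  interpret B: qcategory Q B by fact
  note V = Dist_value[OF \<phi>]
  \<comment> \<open>Since 1 <= A(x,x), composing with A(x,x) can only enlarge the value; this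
    supplies the source-side factor that \<open>Dist_action\<close> asks for.\<close>
  have "\<phi> (x, y) \<sqsubseteq>\<^bsub>qhom Q (tp A x) (tp B y)\<^esub>
      qcomp Q (tp A x) (tp A x) (tp B y) (\<phi> (x, y)) (arr A x x)"
    using A.comp_mono_right[of "tp A x" "tp A x" "tp B y" "\<phi> (x, y)" "qid Q (tp A x)" "arr A x x"]
      o V A.arr_id by simp
  then show ?thesis
    by (rule A.comp_le_trans_right[OF _ _ _ _ _ _ _ _ Dist_action[OF \<phi> o(1,1,2,3)], rotated -1])
      (use o V in auto)
qed

lemma Dist_pre:
  assumes "qcategory Q A" "qcategory Q B" and \<phi>: "\<phi> \<in> carrier (Dist Q A B)"
    and o: "x \<in> obs A" "x' \<in> obs A" "y \<in> obs B"
  shows "qcomp Q (tp A x') (tp A x) (tp B y) (\<phi> (x, y)) (arr A x' x)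
    \<sqsubseteq>\<^bsub>qhom Q (tp A x') (tp B y)\<^esub> \<phi> (x', y)"
proof -
  interpret A: qcategory Q A by fact
  interpret B: qcategory Q B by fact
  note V = Dist_value[OF \<phi>]
  let ?k = "qcomp Q (tp A x') (tp A x) (tp B y) (\<phi> (x, y)) (arr A x' x)"
  have "?k \<sqsubseteq>\<^bsub>qhom Q (tp A x') (tp B y)\<^esub> qcomp Q (tp A x') (tp B y) (tp B y) (arr B y y) ?k"
    using A.comp_mono_left[of "tp A x'" "tp B y" "tp B y" ?k "qid Q (tp B y)" "arr B y y"]
      o V B.arr_id by simp
  from this Dist_action[OF \<phi> o(1,2,3,3)] show ?thesis
    by (rule A.hom_trans[rotated 2]) (use o V in auto)
qed

text \<open>Acting first on the source and then on the target side yields the two-sided action, so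
  \<open>Dist_pre\<close> and \<open>Dist_post\<close> characterise distributors among extensional
  families of arrows. The distributors built below are checked in this form.\<close>

lemma DistI_one_sided:
  assumes "qcategory Q A" "qcategory Q B"
    and "\<phi> \<in> extensional (obs A \<times> obs B)"
    and V: "\<And>x y. \<lbrakk>x \<in> obs A; y \<in> obs B\<rbrakk> \<Longrightarrow> \<phi> (x, y) \<in> carrier (qhom Q (tp A x) (tp B y))"
    and pre: "\<And>x x' y. \<lbrakk>x \<in> obs A; x' \<in> obs A; y \<in> obs B\<rbrakk>
      \<Longrightarrow> qcomp Q (tp A x') (tp A x) (tp B y) (\<phi> (x, y)) (arr A x' x)
        \<sqsubseteq>\<^bsub>qhom Q (tp A x') (tp B y)\<^esub> \<phi> (x', y)"
    and post: "\<And>x y y'. \<lbrakk>x \<in> obs A; y \<in> obs B; y' \<in> obs B\<rbrakk>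
      \<Longrightarrow> qcomp Q (tp A x) (tp B y) (tp B y') (arr B y y') (\<phi> (x, y))
        \<sqsubseteq>\<^bsub>qhom Q (tp A x) (tp B y')\<^esub> \<phi> (x, y')"
  shows "\<phi> \<in> carrier (Dist Q A B)"
proof -
  interpret A: qcategory Q A by fact
  interpret B: qcategory Q B by fact
  show ?thesis
  proof (rule DistI)
    fix x x' y y' assume o: "x \<in> obs A" "x' \<in> obs A" "y \<in> obs B" "y' \<in> obs B"
    show "qcomp Q (tp A x') (tp B y) (tp B y')
          (arr B y y') (qcomp Q (tp A x') (tp A x) (tp B y) (\<phi> (x, y)) (arr A x' x))
        \<sqsubseteq>\<^bsub>qhom Q (tp A x') (tp B y')\<^esub> \<phi> (x', y')"
      by (rule A.comp_le_trans_right[OF _ _ _ _ _ _ _ pre[OF o(1-3)] post[OF o(2-4)]])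
        (use o V in auto)
  qed (use assms(3) V in auto)
qed

text \<open>The hom-arrow of the star is an identity, so its action on a row is trivial and the
  other action is \<open>Dist_post\<close>. Rows serve the definition of \<open>coprincipal\<close>,
  columns that of \<open>principal\<close>.\<close>

lemma Dist_row:
  assumes "qcategory Q A" "qcategory Q B" and \<phi>: "\<phi> \<in> carrier (Dist Q A B)" and x: "x \<in> obs A"
  shows "(\<lambda>(_, y) \<in> {()} \<times> obs B. \<phi> (x, y)) \<in> carrier (Dist Q (star Q (tp A x)) B)"
proof -
  interpret A: qcategory Q A by fact
  interpret B: qcategory Q B by fact
  show ?thesis
    by (rule DistI_one_sided[OF _ assms(2)])
      (use x Dist_value[OF \<phi>] Dist_post[OF assms(1-3)] in \<open>auto intro: A.hom_refl\<close>)
qed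

lemma Dist_column:
  assumes "qcategory Q A" "qcategory Q B" and \<phi>: "\<phi> \<in> carrier (Dist Q A B)" and y: "y \<in> obs B"
  shows "(\<lambda>(x, _) \<in> obs A \<times> {()}. \<phi> (x, y)) \<in> carrier (Dist Q A (star Q (tp B y)))"
proof -
  interpret A: qcategory Q A by fact
  interpret B: qcategory Q B by fact
  show ?thesis
    by (rule DistI_one_sided[OF assms(1)])
      (use y Dist_value[OF \<phi>] Dist_pre[OF assms(1-3)] in \<open>auto intro: A.hom_refl\<close>)
qed

text \<open>Turns an arrow into a distributor between stars. The constant function is extensional
  because the product of the two unit sets is the whole type.\<close>

lemma (in quantaloid) Dist_arrow:
  assumes "X \<in> qob Q" "Y \<in> qob Q" "f \<in> carrier (qhom Q X Y)"
  shows "(\<lambda>_. f) \<in> carrier (Dist Q (star Q X) (star Q Y))"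
  by (rule DistI_one_sided) (use assms in \<open>auto simp: extensional_def intro: hom_refl\<close>)

section \<open>Composites of distributors as joins\<close>

context
  fixes Q :: "('o, 'a) quantaloid_data"
    and A :: "('x, 'o, 'a) qcat" and B :: "('y, 'o, 'a) qcat" and C :: "('z, 'o, 'a) qcat"
    and \<phi> :: "'x \<times> 'y \<Rightarrow> 'a" and \<psi> :: "'y \<times> 'z \<Rightarrow> 'a"
  assumes cats: "qcategory Q A" "qcategory Q B" "qcategory Q C"
    and \<phi>: "\<phi> \<in> carrier (Dist Q A B)" and \<psi>: "\<psi> \<in> carrier (Dist Q B C)"
begin

interpretation A: qcategory Q A by (fact cats)
interpretation B: qcategory Q B by (fact cats)
interpretation C: qcategory Q C by (fact cats)

lemma dcomp_closed:
  assumes "x \<in> obs A" "z \<in> obs C"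
  shows "dcomp Q A B C \<psi> \<phi> (x, z) \<in> carrier (qhom Q (tp A x) (tp C z))"
  using assms Dist_value[OF \<phi>] Dist_value[OF \<psi>]
  by (auto simp: dcomp_def intro!: A.hom_Sup_closed)

lemma dcomp_upper:
  assumes "x \<in> obs A" "y \<in> obs B" "z \<in> obs C"
  shows "qcomp Q (tp A x) (tp B y) (tp C z) (\<psi> (y, z)) (\<phi> (x, y))
    \<sqsubseteq>\<^bsub>qhom Q (tp A x) (tp C z)\<^esub> dcomp Q A B C \<psi> \<phi> (x, z)"
  using assms Dist_value[OF \<phi>] Dist_value[OF \<psi>]
  by (auto simp: dcomp_def intro!: A.hom_Sup_upper)

lemma dcomp_least:
  assumes "x \<in> obs A" "z \<in> obs C" "h \<in> carrier (qhom Q (tp A x) (tp C z))"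
    and "\<And>y. y \<in> obs B \<Longrightarrow> qcomp Q (tp A x) (tp B y) (tp C z) (\<psi> (y, z)) (\<phi> (x, y))
      \<sqsubseteq>\<^bsub>qhom Q (tp A x) (tp C z)\<^esub> h"
  shows "dcomp Q A B C \<psi> \<phi> (x, z) \<sqsubseteq>\<^bsub>qhom Q (tp A x) (tp C z)\<^esub> h"
  using assms Dist_value[OF \<phi>] Dist_value[OF \<psi>]
  by (auto simp: dcomp_def intro!: A.hom_Sup_least)

text \<open>Composition with \<open>g\<close> preserves the join that forms the composite, so a
  bound on every term passes to the whole. The premise brackets \<open>g\<close> with \<psi>, so
  that an action on \<psi> can be applied to it directly.\<close>

lemma comp_dcomp_le:
  assumes o: "x \<in> obs A" "z \<in> obs C" "W \<in> qob Q"
    and g: "g \<in> carrier (qhom Q (tp C z) W)" and h: "h \<in> carrier (qhom Q (tp A x) W)"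
    and le: "\<And>y. y \<in> obs B \<Longrightarrow> qcomp Q (tp A x) (tp B y) W
      (qcomp Q (tp B y) (tp C z) W g (\<psi> (y, z))) (\<phi> (x, y)) \<sqsubseteq>\<^bsub>qhom Q (tp A x) W\<^esub> h"
  shows "qcomp Q (tp A x) (tp C z) W g (dcomp Q A B C \<psi> \<phi> (x, z)) \<sqsubseteq>\<^bsub>qhom Q (tp A x) W\<^esub> h"
proof -
  let ?S = "(\<lambda>y. qcomp Q (tp A x) (tp B y) (tp C z) (\<psi> (y, z)) (\<phi> (x, y))) ` obs B"
  note V = Dist_value[OF \<phi>] Dist_value[OF \<psi>]
  have S: "?S \<subseteq> carrier (qhom Q (tp A x) (tp C z))" using o V by auto
  have "qcomp Q (tp A x) (tp C z) W g (\<Squnion>\<^bsub>qhom Q (tp A x) (tp C z)\<^esub> ?S)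
      \<sqsubseteq>\<^bsub>qhom Q (tp A x) W\<^esub> h"
    using o g h S V le
    by (auto simp: A.comp_Sup_right[OF _ _ _ S] A.comp_assoc intro!: A.hom_Sup_least)
  then show ?thesis using o by (simp add: dcomp_def)
qed

lemma dcomp_comp_le:
  assumes o: "x \<in> obs A" "z \<in> obs C" "W \<in> qob Q"
    and g: "g \<in> carrier (qhom Q W (tp A x))" and h: "h \<in> carrier (qhom Q W (tp C z))"
    and le: "\<And>y. y \<in> obs B \<Longrightarrow> qcomp Q W (tp B y) (tp C z) (\<psi> (y, z))
      (qcomp Q W (tp A x) (tp B y) (\<phi> (x, y)) g) \<sqsubseteq>\<^bsub>qhom Q W (tp C z)\<^esub> h"
  shows "qcomp Q W (tp A x) (tp C z) (dcomp Q A B C \<psi> \<phi> (x, z)) g \<sqsubseteq>\<^bsub>qhom Q W (tp C z)\<^esub> h"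
proof -
  let ?S = "(\<lambda>y. qcomp Q (tp A x) (tp B y) (tp C z) (\<psi> (y, z)) (\<phi> (x, y))) ` obs B"
  note V = Dist_value[OF \<phi>] Dist_value[OF \<psi>]
  have S: "?S \<subseteq> carrier (qhom Q (tp A x) (tp C z))" using o V by auto
  have "qcomp Q W (tp A x) (tp C z) (\<Squnion>\<^bsub>qhom Q (tp A x) (tp C z)\<^esub> ?S) g
      \<sqsubseteq>\<^bsub>qhom Q W (tp C z)\<^esub> h"
    using o g h S V le
    by (auto simp: A.comp_Sup_left[OF _ _ _ _ S] A.comp_assoc[symmetric] intro!: A.hom_Sup_least)
  then show ?thesis using o by (simp add: dcomp_def)
qed

text \<open>Each action meets the terms of the join one by one and is absorbed by the adjacent
  factor: \<phi> on the source side, \<psi> on the target side.\<close>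

lemma dcomp_Dist: "dcomp Q A B C \<psi> \<phi> \<in> carrier (Dist Q A C)"
proof (rule DistI_one_sided[OF cats(1,3)])
  note V = Dist_value[OF \<phi>] Dist_value[OF \<psi>] dcomp_closed
  show "dcomp Q A B C \<psi> \<phi> \<in> extensional (obs A \<times> obs C)" by (simp add: dcomp_def)
  fix x z assume o: "x \<in> obs A" "z \<in> obs C"
  { fix x' assume o': "x' \<in> obs A"
    show "qcomp Q (tp A x') (tp A x) (tp C z) (dcomp Q A B C \<psi> \<phi> (x, z)) (arr A x' x)
        \<sqsubseteq>\<^bsub>qhom Q (tp A x') (tp C z)\<^esub> dcomp Q A B C \<psi> \<phi> (x', z)"
    proof (rule dcomp_comp_le)
      fix y assume y: "y \<in> obs B"
      show "qcomp Q (tp A x') (tp B y) (tp C z) (\<psi> (y, z))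
          (qcomp Q (tp A x') (tp A x) (tp B y) (\<phi> (x, y)) (arr A x' x))
          \<sqsubseteq>\<^bsub>qhom Q (tp A x') (tp C z)\<^esub> dcomp Q A B C \<psi> \<phi> (x', z)"
        by (rule A.comp_le_trans_right[OF _ _ _ _ _ _ _
              Dist_pre[OF cats(1,2) \<phi> o(1) o' y] dcomp_upper[OF o' y o(2)]])
          (use o o' y V in auto)
    qed (use o o' V in auto) }
  { fix z' assume o': "z' \<in> obs C"
    show "qcomp Q (tp A x) (tp C z) (tp C z') (arr C z z') (dcomp Q A B C \<psi> \<phi> (x, z))
        \<sqsubseteq>\<^bsub>qhom Q (tp A x) (tp C z')\<^esub> dcomp Q A B C \<psi> \<phi> (x, z')"
    proof (rule comp_dcomp_le)
      fix y assume y: "y \<in> obs B"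
      show "qcomp Q (tp A x) (tp B y) (tp C z')
          (qcomp Q (tp B y) (tp C z) (tp C z') (arr C z z') (\<psi> (y, z))) (\<phi> (x, y))
          \<sqsubseteq>\<^bsub>qhom Q (tp A x) (tp C z')\<^esub> dcomp Q A B C \<psi> \<phi> (x, z')"
        by (rule A.comp_le_trans_left[OF _ _ _ _ _ _ _
              Dist_post[OF cats(2,3) \<psi> y o(2) o'] dcomp_upper[OF o(1) y o']])
          (use o o' y V in auto)
    qed (use o o' V in auto) }
qed (use dcomp_closed in auto)

end

section \<open>Residuals value by value\<close>

text \<open>\<open>res_sw\<close> is specified by adjointness among whole distributors; here it is
  tested on a single arrow \<open>d\<close>. Forwards, the residual itself is composed with \<phi>;
  backwards, \<open>d\<close> is extended to a distributor.\<close>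

lemma res_sw_le_iff:
  assumes cats: "qcategory Q A" "qcategory Q B" "qcategory Q C"
    and \<phi>: "\<phi> \<in> carrier (Dist Q A B)" and \<chi>: "\<chi> \<in> carrier (Dist Q A C)"
    and o: "y \<in> obs B" "z \<in> obs C" and d: "d \<in> carrier (qhom Q (tp B y) (tp C z))"
  shows "d \<sqsubseteq>\<^bsub>qhom Q (tp B y) (tp C z)\<^esub> res_sw Q A B C \<chi> \<phi> (y, z) \<longleftrightarrow>
    (\<forall>x\<in>obs A. qcomp Q (tp A x) (tp B y) (tp C z) d (\<phi> (x, y))
       \<sqsubseteq>\<^bsub>qhom Q (tp A x) (tp C z)\<^esub> \<chi> (x, z))" (is "?L \<longleftrightarrow> ?R")
proof -
  interpret A: qcategory Q A by fact
  interpret B: qcategory Q B by fact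
  interpret C: qcategory Q C by fact
  note q = A.quantaloid_axioms
  let ?\<rho> = "res_sw Q A B C \<chi> \<phi>"
  note adj = res_sw_adjoint[OF q cats \<phi> \<chi>]
  have \<rho>: "?\<rho> \<in> carrier (Dist Q B C)" using adj by simp
  have "dcomp Q A B C ?\<rho> \<phi> \<sqsubseteq>\<^bsub>Dist Q A C\<^esub> \<chi>"
    using adj \<rho> Dist_refl[OF q cats(2,3) \<rho>] by simp
  then have \<rho>_le: "qcomp Q (tp A x) (tp B y) (tp C z) (?\<rho> (y, z)) (\<phi> (x, y))
      \<sqsubseteq>\<^bsub>qhom Q (tp A x) (tp C z)\<^esub> \<chi> (x, z)" if "x \<in> obs A" for x
    unfolding dcomp_le_iff[OF q cats \<rho> \<phi> \<chi>] using o that by simp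
  note V = Dist_value[OF \<phi>] Dist_value[OF \<chi>] Dist_value[OF \<rho>]
  show ?thesis
  proof
    assume L: ?L
    show ?R
    proof
      fix x assume x: "x \<in> obs A"
      show "qcomp Q (tp A x) (tp B y) (tp C z) d (\<phi> (x, y))
        \<sqsubseteq>\<^bsub>qhom Q (tp A x) (tp C z)\<^esub> \<chi> (x, z)"
        by (rule A.comp_le_trans_left[OF _ _ _ _ _ _ _ L \<rho>_le[OF x]]) (use x o d V in auto)
    qed
  next
    assume R: ?R
    \<comment> \<open>The distributor C(z,-) o d o B(-,y) generated by \<open>d\<close> at
      \<open>(y, z)\<close>; both of its actions reduce to \<open>arr_comp\<close>.\<close>
    define \<delta> where "\<delta> = (\<lambda>(y', z') \<in> obs B \<times> obs C.
      qcomp Q (tp B y') (tp C z) (tp C z') (arr C z z')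
        (qcomp Q (tp B y') (tp B y) (tp C z) d (arr B y' y)))"
    have \<delta>: "\<delta> \<in> carrier (Dist Q B C)"
    proof (rule DistI_one_sided[OF cats(2,3)])
      fix y' y'' z' assume o': "y' \<in> obs B" "y'' \<in> obs B" "z' \<in> obs C"
      have "qcomp Q (tp B y'') (tp B y') (tp C z') (\<delta> (y', z')) (arr B y'' y')
        = qcomp Q (tp B y'') (tp C z) (tp C z') (arr C z z') (qcomp Q (tp B y'') (tp B y) (tp C z) d
            (qcomp Q (tp B y'') (tp B y') (tp B y) (arr B y' y) (arr B y'' y')))"
        using o o' d by (simp add: \<delta>_def A.comp_assoc)
      also have "\<dots> \<sqsubseteq>\<^bsub>qhom Q (tp B y'') (tp C z')\<^esub> \<delta> (y'', z')"
        using o o' d B.arr_comp by (auto simp: \<delta>_def intro!: A.comp_mono_right)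
      finally show "qcomp Q (tp B y'') (tp B y') (tp C z') (\<delta> (y', z')) (arr B y'' y')
        \<sqsubseteq>\<^bsub>qhom Q (tp B y'') (tp C z')\<^esub> \<delta> (y'', z')" .
    next
      fix y' z' z'' assume o': "y' \<in> obs B" "z' \<in> obs C" "z'' \<in> obs C"
      show "qcomp Q (tp B y') (tp C z') (tp C z'') (arr C z' z'') (\<delta> (y', z'))
        \<sqsubseteq>\<^bsub>qhom Q (tp B y') (tp C z'')\<^esub> \<delta> (y', z'')"
        using o o' d C.arr_comp
        by (auto simp: \<delta>_def A.comp_assoc[of "tp B y'" "tp C z"] intro!: A.comp_mono_left)
    qed (use o d in \<open>auto simp: \<delta>_def\<close>)
    have "dcomp Q A B C \<delta> \<phi> \<sqsubseteq>\<^bsub>Dist Q A C\<^esub> \<chi>"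
      unfolding dcomp_le_iff[OF q cats \<delta> \<phi> \<chi>]
    proof (intro ballI)
      fix x y' z' assume o': "x \<in> obs A" "y' \<in> obs B" "z' \<in> obs C"
      \<comment> \<open>B(y',y) is absorbed by \<phi>, then \<open>R\<close> applies at
        \<open>y\<close>; in the next step C(z,z') is absorbed by \<chi>.\<close>
      have "qcomp Q (tp A x) (tp B y) (tp C z) d
          (qcomp Q (tp A x) (tp B y') (tp B y) (arr B y' y) (\<phi> (x, y')))
          \<sqsubseteq>\<^bsub>qhom Q (tp A x) (tp C z)\<^esub> \<chi> (x, z)"
        by (rule A.comp_le_trans_right[OF _ _ _ _ _ _ _
              Dist_post[OF cats(1,2) \<phi> o'(1,2) o(1)]]) (use o o' d V R in auto)
      then have "qcomp Q (tp A x) (tp C z) (tp C z') (arr C z z') (qcomp Q (tp A x) (tp B y) (tp C z) d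
          (qcomp Q (tp A x) (tp B y') (tp B y) (arr B y' y) (\<phi> (x, y'))))
          \<sqsubseteq>\<^bsub>qhom Q (tp A x) (tp C z')\<^esub> \<chi> (x, z')"
        by (rule A.comp_le_trans_right[OF _ _ _ _ _ _ _ _
              Dist_post[OF cats(1,3) \<chi> o'(1) o(2) o'(3)], rotated -1]) (use o o' d V in auto)
      then show "qcomp Q (tp A x) (tp B y') (tp C z') (\<delta> (y', z')) (\<phi> (x, y'))
          \<sqsubseteq>\<^bsub>qhom Q (tp A x) (tp C z')\<^esub> \<chi> (x, z')"
        using o o' d V by (simp add: \<delta>_def A.comp_assoc)
    qed
    then have "\<delta> (y, z) \<sqsubseteq>\<^bsub>qhom Q (tp B y) (tp C z)\<^esub> ?\<rho> (y, z)"
      using adj \<delta> o by (auto simp: Dist_le)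
    \<comment> \<open>The redundant identities keep the left side in the shape of \<delta>, so that
      \<open>comp_mono\<close> with 1 <= B(y,y) and 1 <= C(z,z) gives d <= \<delta>(y,z). For this
      reason the identity laws are withheld from the simplifier.\<close>
    moreover have "qcomp Q (tp B y) (tp C z) (tp C z) (qid Q (tp C z))
        (qcomp Q (tp B y) (tp B y) (tp C z) d (qid Q (tp B y)))
        \<sqsubseteq>\<^bsub>qhom Q (tp B y) (tp C z)\<^esub> \<delta> (y, z)"
      unfolding \<delta>_def using o d B.arr_id C.arr_id
      by (auto simp del: A.id_left A.id_right intro!: A.comp_mono A.hom_refl)
    ultimately show ?L
      using o d V Dist_value[OF \<delta>] by (auto intro: A.hom_trans)
  qed
qed

text \<open>Mirror image of \<open>res_sw_le_iff\<close>, with generated distributor B(y,-) o d o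
  A(-,x).\<close>

lemma res_se_le_iff:
  assumes cats: "qcategory Q A" "qcategory Q B" "qcategory Q C"
    and \<psi>: "\<psi> \<in> carrier (Dist Q B C)" and \<chi>: "\<chi> \<in> carrier (Dist Q A C)"
    and o: "x \<in> obs A" "y \<in> obs B" and d: "d \<in> carrier (qhom Q (tp A x) (tp B y))"
  shows "d \<sqsubseteq>\<^bsub>qhom Q (tp A x) (tp B y)\<^esub> res_se Q A B C \<psi> \<chi> (x, y) \<longleftrightarrow>
    (\<forall>z\<in>obs C. qcomp Q (tp A x) (tp B y) (tp C z) (\<psi> (y, z)) d
       \<sqsubseteq>\<^bsub>qhom Q (tp A x) (tp C z)\<^esub> \<chi> (x, z))" (is "?L \<longleftrightarrow> ?R")
proof -
  interpret A: qcategory Q A by fact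
  interpret B: qcategory Q B by fact
  interpret C: qcategory Q C by fact
  note q = A.quantaloid_axioms
  let ?\<rho> = "res_se Q A B C \<psi> \<chi>"
  note adj = res_se_adjoint[OF q cats \<psi> \<chi>]
  have \<rho>: "?\<rho> \<in> carrier (Dist Q A B)" using adj by simp
  have "dcomp Q A B C \<psi> ?\<rho> \<sqsubseteq>\<^bsub>Dist Q A C\<^esub> \<chi>"
    using adj \<rho> Dist_refl[OF q cats(1,2) \<rho>] by simp
  then have \<rho>_le: "qcomp Q (tp A x) (tp B y) (tp C z) (\<psi> (y, z)) (?\<rho> (x, y))
      \<sqsubseteq>\<^bsub>qhom Q (tp A x) (tp C z)\<^esub> \<chi> (x, z)" if "z \<in> obs C" for z
    unfolding dcomp_le_iff[OF q cats \<psi> \<rho> \<chi>] using o that by simp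
  note V = Dist_value[OF \<psi>] Dist_value[OF \<chi>] Dist_value[OF \<rho>]
  show ?thesis
  proof
    assume L: ?L
    show ?R
    proof
      fix z assume z: "z \<in> obs C"
      show "qcomp Q (tp A x) (tp B y) (tp C z) (\<psi> (y, z)) d
        \<sqsubseteq>\<^bsub>qhom Q (tp A x) (tp C z)\<^esub> \<chi> (x, z)"
        by (rule A.comp_le_trans_right[OF _ _ _ _ _ _ _ L \<rho>_le[OF z]]) (use z o d V in auto)
    qed
  next
    assume R: ?R
    define \<delta> where "\<delta> = (\<lambda>(x', y') \<in> obs A \<times> obs B.
      qcomp Q (tp A x') (tp B y) (tp B y') (arr B y y')
        (qcomp Q (tp A x') (tp A x) (tp B y) d (arr A x' x)))"
    have \<delta>: "\<delta> \<in> carrier (Dist Q A B)"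
    proof (rule DistI_one_sided[OF cats(1,2)])
      fix x' x'' y' assume o': "x' \<in> obs A" "x'' \<in> obs A" "y' \<in> obs B"
      have "qcomp Q (tp A x'') (tp A x') (tp B y') (\<delta> (x', y')) (arr A x'' x')
        = qcomp Q (tp A x'') (tp B y) (tp B y') (arr B y y') (qcomp Q (tp A x'') (tp A x) (tp B y) d
            (qcomp Q (tp A x'') (tp A x') (tp A x) (arr A x' x) (arr A x'' x')))"
        using o o' d by (simp add: \<delta>_def A.comp_assoc)
      also have "\<dots> \<sqsubseteq>\<^bsub>qhom Q (tp A x'') (tp B y')\<^esub> \<delta> (x'', y')"
        using o o' d A.arr_comp by (auto simp: \<delta>_def intro!: A.comp_mono_right)
      finally show "qcomp Q (tp A x'') (tp A x') (tp B y') (\<delta> (x', y')) (arr A x'' x')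
        \<sqsubseteq>\<^bsub>qhom Q (tp A x'') (tp B y')\<^esub> \<delta> (x'', y')" .
    next
      fix x' y' y'' assume o': "x' \<in> obs A" "y' \<in> obs B" "y'' \<in> obs B"
      show "qcomp Q (tp A x') (tp B y') (tp B y'') (arr B y' y'') (\<delta> (x', y'))
        \<sqsubseteq>\<^bsub>qhom Q (tp A x') (tp B y'')\<^esub> \<delta> (x', y'')"
        using o o' d B.arr_comp
        by (auto simp: \<delta>_def A.comp_assoc[of "tp A x'" "tp B y"] intro!: A.comp_mono_left)
    qed (use o d in \<open>auto simp: \<delta>_def\<close>)
    have "dcomp Q A B C \<psi> \<delta> \<sqsubseteq>\<^bsub>Dist Q A C\<^esub> \<chi>"
      unfolding dcomp_le_iff[OF q cats \<psi> \<delta> \<chi>]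
    proof (intro ballI)
      fix x' y' z assume o': "x' \<in> obs A" "y' \<in> obs B" "z \<in> obs C"
      have "qcomp Q (tp A x) (tp B y) (tp C z)
          (qcomp Q (tp B y) (tp B y') (tp C z) (\<psi> (y', z)) (arr B y y')) d
          \<sqsubseteq>\<^bsub>qhom Q (tp A x) (tp C z)\<^esub> \<chi> (x, z)"
        by (rule A.comp_le_trans_left[OF _ _ _ _ _ _ _
              Dist_pre[OF cats(2,3) \<psi> o'(2) o(2) o'(3)]]) (use o o' d V R in auto)
      then have "qcomp Q (tp A x') (tp A x) (tp C z) (qcomp Q (tp A x) (tp B y) (tp C z)
          (qcomp Q (tp B y) (tp B y') (tp C z) (\<psi> (y', z)) (arr B y y')) d) (arr A x' x)
          \<sqsubseteq>\<^bsub>qhom Q (tp A x') (tp C z)\<^esub> \<chi> (x', z)"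
        by (rule A.comp_le_trans_left[OF _ _ _ _ _ _ _ _
              Dist_pre[OF cats(1,3) \<chi> o(1) o'(1,3)], rotated -1]) (use o o' d V in auto)
      then show "qcomp Q (tp A x') (tp B y') (tp C z) (\<psi> (y', z)) (\<delta> (x', y'))
          \<sqsubseteq>\<^bsub>qhom Q (tp A x') (tp C z)\<^esub> \<chi> (x', z)"
        using o o' d V by (simp add: \<delta>_def A.comp_assoc)
    qed
    then have "\<delta> (x, y) \<sqsubseteq>\<^bsub>qhom Q (tp A x) (tp B y)\<^esub> ?\<rho> (x, y)"
      using adj \<delta> o by (auto simp: Dist_le)
    moreover have "qcomp Q (tp A x) (tp B y) (tp B y) (qid Q (tp B y))
        (qcomp Q (tp A x) (tp A x) (tp B y) d (qid Q (tp A x)))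
        \<sqsubseteq>\<^bsub>qhom Q (tp A x) (tp B y)\<^esub> \<delta> (x, y)"
      unfolding \<delta>_def using o d A.arr_id B.arr_id
      by (auto simp del: A.id_left A.id_right intro!: A.comp_mono A.hom_refl)
    ultimately show ?L
      using o d V Dist_value[OF \<delta>] by (auto intro: A.hom_trans)
  qed
qed


section \<open>Presheaves, copresheaves and adjunctions\<close>

context qcategory
begin

lemma presheaf_obs_iff:
  "p \<in> obs (presheaf_cat Q A) \<longleftrightarrow>
    fst p \<in> qob Q \<and> snd p \<in> carrier (Dist Q A (star Q (fst p)))"
  by (cases p) (simp add: presheaf_cat_def)

lemma copresheaf_obs_iff:
  "p \<in> obs (copresheaf_cat Q A) \<longleftrightarrow>
    fst p \<in> qob Q \<and> snd p \<in> carrier (Dist Q (star Q (fst p)) A)"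
  by (cases p) (simp add: copresheaf_cat_def)

lemma presheaf_tp [simp]: "tp (presheaf_cat Q A) = fst"
  by (simp add: presheaf_cat_def)

lemma copresheaf_tp [simp]: "tp (copresheaf_cat Q A) = fst"
  by (simp add: copresheaf_cat_def)

lemma presheaf_value [simp]:
  assumes "p \<in> obs (presheaf_cat Q A)" "x \<in> obs A"
  shows "snd p (x, ()) \<in> carrier (qhom Q (tp A x) (fst p))"
  using Dist_value[of "snd p" Q A "star Q (fst p)" x "()"] assms by (simp add: presheaf_obs_iff)

lemma copresheaf_value [simp]:
  assumes "p \<in> obs (copresheaf_cat Q A)" "x \<in> obs A"
  shows "snd p ((), x) \<in> carrier (qhom Q (fst p) (tp A x))"
  using Dist_value[of "snd p" Q "star Q (fst p)" A "()" x] assms by (simp add: copresheaf_obs_iff)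

lemma presheaf_arr_closed:
  assumes "p \<in> obs (presheaf_cat Q A)" "q \<in> obs (presheaf_cat Q A)"
  shows "arr (presheaf_cat Q A) p q \<in> carrier (qhom Q (fst p) (fst q))"
proof -
  have "res_sw Q A (star Q (fst p)) (star Q (fst q)) (snd q) (snd p)
      \<in> carrier (Dist Q (star Q (fst p)) (star Q (fst q)))"
    using res_sw_adjoint[OF quantaloid_axioms qcategory_axioms qcategory_star qcategory_star] assms
    by (simp add: presheaf_obs_iff)
  from Dist_value[OF this, of "()" "()"] show ?thesis
    by (simp add: presheaf_cat_def split_beta)
qed

lemma copresheaf_arr_closed:
  assumes "p \<in> obs (copresheaf_cat Q A)" "q \<in> obs (copresheaf_cat Q A)"
  shows "arr (copresheaf_cat Q A) p q \<in> carrier (qhom Q (fst p) (fst q))"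
proof -
  have "res_se Q (star Q (fst p)) (star Q (fst q)) A (snd q) (snd p)
      \<in> carrier (Dist Q (star Q (fst p)) (star Q (fst q)))"
    using res_se_adjoint[OF quantaloid_axioms qcategory_star qcategory_star qcategory_axioms] assms
    by (simp add: copresheaf_obs_iff)
  from Dist_value[OF this, of "()" "()"] show ?thesis
    by (simp add: copresheaf_cat_def split_beta)
qed

text \<open>\<open>res_sw_le_iff\<close> at the only objects of the two stars. With \<open>f\<close>
  the hom-arrow from \<open>p\<close> to \<open>q\<close> itself it says that this arrow carries
  \<open>p\<close> below \<open>q\<close>, from which the composition law of presheaves
  follows.\<close>

lemma presheaf_arr_le_iff:
  assumes "p \<in> obs (presheaf_cat Q A)" "q \<in> obs (presheaf_cat Q A)"
    and "f \<in> carrier (qhom Q (fst p) (fst q))"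
  shows "f \<sqsubseteq>\<^bsub>qhom Q (fst p) (fst q)\<^esub> arr (presheaf_cat Q A) p q \<longleftrightarrow>
    (\<forall>x\<in>obs A. qcomp Q (tp A x) (fst p) (fst q) f (snd p (x, ()))
       \<sqsubseteq>\<^bsub>qhom Q (tp A x) (fst q)\<^esub> snd q (x, ()))"
  using res_sw_le_iff[OF qcategory_axioms qcategory_star qcategory_star,
      of "fst p" "fst q" "snd p" "snd q" "()" "()" f] assms
  by (simp add: presheaf_obs_iff) (simp add: presheaf_cat_def split_beta)

text \<open>The roles of \<open>p\<close> and \<open>q\<close> are exchanged compared with
  presheaves: at equal types the underlying order of copresheaves is the reverse of the pointwise
  one.\<close>

lemma copresheaf_arr_le_iff:
  assumes "p \<in> obs (copresheaf_cat Q A)" "q \<in> obs (copresheaf_cat Q A)"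
    and "f \<in> carrier (qhom Q (fst p) (fst q))"
  shows "f \<sqsubseteq>\<^bsub>qhom Q (fst p) (fst q)\<^esub> arr (copresheaf_cat Q A) p q \<longleftrightarrow>
    (\<forall>x\<in>obs A. qcomp Q (fst p) (fst q) (tp A x) (snd q ((), x)) f
       \<sqsubseteq>\<^bsub>qhom Q (fst p) (tp A x)\<^esub> snd p ((), x))"
  using res_se_le_iff[OF qcategory_star qcategory_star qcategory_axioms,
      of "fst p" "fst q" "snd q" "snd p" "()" "()" f] assms
  by (simp add: copresheaf_obs_iff) (simp add: copresheaf_cat_def split_beta)

lemma qcategory_presheaf: "qcategory Q (presheaf_cat Q A)"
proof unfold_locales
  let ?P = "presheaf_cat Q A"
  show "tp ?P p \<in> qob Q" if "p \<in> obs ?P" for p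
    using that by (simp add: presheaf_obs_iff)
  show "arr ?P p q \<in> carrier (qhom Q (tp ?P p) (tp ?P q))" if "p \<in> obs ?P" "q \<in> obs ?P" for p q
    using that by (simp add: presheaf_arr_closed)
  show "qid Q (tp ?P p) \<sqsubseteq>\<^bsub>qhom Q (tp ?P p) (tp ?P p)\<^esub> arr ?P p p"
    if p: "p \<in> obs ?P" for p
  proof -
    have "fst p \<in> qob Q" using p by (simp add: presheaf_obs_iff)
    then show ?thesis using p by (auto simp: presheaf_arr_le_iff intro: hom_refl)
  qed
  fix p q r assume o: "p \<in> obs ?P" "q \<in> obs ?P" "r \<in> obs ?P"
  then have t: "fst p \<in> qob Q" "fst q \<in> qob Q" "fst r \<in> qob Q" by (simp_all add: presheaf_obs_iff)
  note C = presheaf_arr_closed[OF o(1,2)] presheaf_arr_closed[OF o(2,3)]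
  have "qcomp Q (tp A x) (fst p) (fst r) (qcomp Q (fst p) (fst q) (fst r) (arr ?P q r) (arr ?P p q))
      (snd p (x, ())) \<sqsubseteq>\<^bsub>qhom Q (tp A x) (fst r)\<^esub> snd r (x, ())" if x: "x \<in> obs A" for x
  proof -
    have 1: "qcomp Q (tp A x) (fst p) (fst q) (arr ?P p q) (snd p (x, ()))
        \<sqsubseteq>\<^bsub>qhom Q (tp A x) (fst q)\<^esub> snd q (x, ())"
      using presheaf_arr_le_iff[OF o(1,2) C(1)] hom_refl C t x by simp
    have 2: "qcomp Q (tp A x) (fst q) (fst r) (arr ?P q r) (snd q (x, ()))
        \<sqsubseteq>\<^bsub>qhom Q (tp A x) (fst r)\<^esub> snd r (x, ())"
      using presheaf_arr_le_iff[OF o(2,3) C(2)] hom_refl C t x by simp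
    have "qcomp Q (tp A x) (fst q) (fst r) (arr ?P q r)
        (qcomp Q (tp A x) (fst p) (fst q) (arr ?P p q) (snd p (x, ())))
        \<sqsubseteq>\<^bsub>qhom Q (tp A x) (fst r)\<^esub> snd r (x, ())"
      by (rule comp_le_trans_right[OF _ _ _ _ _ _ _ 1 2]) (use x o t C in auto)
    then show ?thesis using x o t C by (simp add: comp_assoc)
  qed
  then show "qcomp Q (tp ?P p) (tp ?P q) (tp ?P r) (arr ?P q r) (arr ?P p q)
      \<sqsubseteq>\<^bsub>qhom Q (tp ?P p) (tp ?P r)\<^esub> arr ?P p r"
    using o t C by (simp add: presheaf_arr_le_iff)
qed

lemma qcategory_copresheaf: "qcategory Q (copresheaf_cat Q A)"
proof unfold_locales
  let ?P = "copresheaf_cat Q A"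
  show "tp ?P p \<in> qob Q" if "p \<in> obs ?P" for p
    using that by (simp add: copresheaf_obs_iff)
  show "arr ?P p q \<in> carrier (qhom Q (tp ?P p) (tp ?P q))" if "p \<in> obs ?P" "q \<in> obs ?P" for p q
    using that by (simp add: copresheaf_arr_closed)
  show "qid Q (tp ?P p) \<sqsubseteq>\<^bsub>qhom Q (tp ?P p) (tp ?P p)\<^esub> arr ?P p p"
    if p: "p \<in> obs ?P" for p
  proof -
    have "fst p \<in> qob Q" using p by (simp add: copresheaf_obs_iff)
    then show ?thesis using p by (auto simp: copresheaf_arr_le_iff intro: hom_refl)
  qed
  fix p q r assume o: "p \<in> obs ?P" "q \<in> obs ?P" "r \<in> obs ?P"
  then have t: "fst p \<in> qob Q" "fst q \<in> qob Q" "fst r \<in> qob Q"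
    by (simp_all add: copresheaf_obs_iff)
  note C = copresheaf_arr_closed[OF o(1,2)] copresheaf_arr_closed[OF o(2,3)]
  have "qcomp Q (fst p) (fst r) (tp A x) (snd r ((), x))
      (qcomp Q (fst p) (fst q) (fst r) (arr ?P q r) (arr ?P p q))
      \<sqsubseteq>\<^bsub>qhom Q (fst p) (tp A x)\<^esub> snd p ((), x)" if x: "x \<in> obs A" for x
  proof -
    have 1: "qcomp Q (fst p) (fst q) (tp A x) (snd q ((), x)) (arr ?P p q)
        \<sqsubseteq>\<^bsub>qhom Q (fst p) (tp A x)\<^esub> snd p ((), x)"
      using copresheaf_arr_le_iff[OF o(1,2) C(1)] hom_refl C t x by simp
    have 2: "qcomp Q (fst q) (fst r) (tp A x) (snd r ((), x)) (arr ?P q r)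
        \<sqsubseteq>\<^bsub>qhom Q (fst q) (tp A x)\<^esub> snd q ((), x)"
      using copresheaf_arr_le_iff[OF o(2,3) C(2)] hom_refl C t x by simp
    have "qcomp Q (fst p) (fst q) (tp A x)
        (qcomp Q (fst q) (fst r) (tp A x) (snd r ((), x)) (arr ?P q r)) (arr ?P p q)
        \<sqsubseteq>\<^bsub>qhom Q (fst p) (tp A x)\<^esub> snd p ((), x)"
      by (rule comp_le_trans_left[OF _ _ _ _ _ _ _ 2 1]) (use x o t C in auto)
    then show ?thesis using x o t C by (simp add: comp_assoc)
  qed
  then show "qcomp Q (tp ?P p) (tp ?P q) (tp ?P r) (arr ?P q r) (arr ?P p q)
      \<sqsubseteq>\<^bsub>qhom Q (tp ?P p) (tp ?P r)\<^esub> arr ?P p r"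
    using o t C by (simp add: copresheaf_arr_le_iff)
qed

lemma qcategory_full_subcategory:
  assumes "S \<subseteq> obs A"
  shows "qcategory Q (A\<lparr>obs := S\<rparr>)"
  using assms arr_id arr_comp by unfold_locales (auto simp: subset_iff)

section \<open>The underlying order and adjoint functors\<close>

lemma qcat_le_arr_mono:
  assumes o: "x \<in> obs A" "x' \<in> obs A" "y \<in> obs A" "y' \<in> obs A"
    and le: "qcat_le Q A x x'" "qcat_le Q A y y'"
  shows "arr A x' y \<sqsubseteq>\<^bsub>qhom Q (tp A x) (tp A y)\<^esub> arr A x y'"
proof -
  have t: "tp A x' = tp A x" "tp A y' = tp A y" using le by (auto simp: qcat_le_def)
  have c: "arr A x' y \<in> carrier (qhom Q (tp A x) (tp A y))"
    "arr A x' y' \<in> carrier (qhom Q (tp A x) (tp A y))"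
    "arr A y y' \<in> carrier (qhom Q (tp A y) (tp A y))"
    "arr A x x' \<in> carrier (qhom Q (tp A x) (tp A x))"
    "arr A x y' \<in> carrier (qhom Q (tp A x) (tp A y))"
    using arr_closed o t by metis+
  \<comment> \<open>The identity stands below A(y,y') because y <= y'; the first argument is then
    treated in the same way with A(x,x'). Hom-arrows are thus covariant in the second and
    contravariant in the first argument.\<close>
  have "qcomp Q (tp A x) (tp A y) (tp A y) (qid Q (tp A y)) (arr A x' y)
      \<sqsubseteq>\<^bsub>qhom Q (tp A x) (tp A y)\<^esub> arr A x' y'"
    by (rule comp_le_trans_left[of _ _ _ _ _ "arr A y y'"])
      (use le o t c arr_comp[OF o(2,3,4)] in \<open>auto simp: qcat_le_def\<close>)
  moreover have "qcomp Q (tp A x) (tp A x) (tp A y) (arr A x' y') (qid Q (tp A x))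
      \<sqsubseteq>\<^bsub>qhom Q (tp A x) (tp A y)\<^esub> arr A x y'"
    by (rule comp_le_trans_right[of _ _ _ _ _ "arr A x x'"])
      (use le o t c arr_comp[OF o(1,2,4)] in \<open>auto simp: qcat_le_def\<close>)
  ultimately show ?thesis
    using hom_trans[of "tp A x" "tp A y" "arr A x' y" "arr A x' y'" "arr A x y'"] o c by simp
qed

lemma qcat_le_refl: "x \<in> obs A \<Longrightarrow> qcat_le Q A x x"
  using arr_id by (simp add: qcat_le_def)

end

text \<open>Passes from unit and counit to the hom-arrow form of an adjunction through the cycle
  B(Fx,y) <= A(GFx,Gy) <= A(x,Gy) <= B(Fx,FGy) <= B(Fx,y).\<close>

lemma qadjoint_arr_eq:
  assumes "qcategory Q A" "qcategory Q B" and adj: "qadjoint Q A B F G"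
    and o: "x \<in> obs A" "y \<in> obs B"
  shows "arr B (F x) y = arr A x (G y)"
proof -
  interpret A: qcategory Q A by fact
  interpret B: qcategory Q B by fact
  have F: "F x \<in> obs B" "tp B (F x) = tp A x" and G: "G y \<in> obs A" "tp A (G y) = tp B y"
    using adj o by (auto simp: qadjoint_def qfunctor_def)
  have GF: "G (F x) \<in> obs A" "tp A (G (F x)) = tp A x"
    and FG: "F (G y) \<in> obs B" "tp B (F (G y)) = tp B y"
    using adj o F G by (auto simp: qadjoint_def qfunctor_def)
  have c: "arr B (F x) y \<in> carrier (qhom Q (tp A x) (tp B y))"
    "arr A x (G y) \<in> carrier (qhom Q (tp A x) (tp B y))"
    "arr A (G (F x)) (G y) \<in> carrier (qhom Q (tp A x) (tp B y))"
    "arr B (F x) (F (G y)) \<in> carrier (qhom Q (tp A x) (tp B y))"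
    using A.arr_closed B.arr_closed o F G GF FG by metis+
  have "arr B (F x) y \<sqsubseteq>\<^bsub>qhom Q (tp A x) (tp B y)\<^esub> arr A (G (F x)) (G y)"
    using adj o F unfolding qadjoint_def qfunctor_def by metis
  moreover have "arr A (G (F x)) (G y) \<sqsubseteq>\<^bsub>qhom Q (tp A x) (tp B y)\<^esub> arr A x (G y)"
    using A.qcat_le_arr_mono[of x "G (F x)" "G y" "G y"] adj o F G GF A.qcat_le_refl
    by (auto simp: qadjoint_def)
  moreover have "arr A x (G y) \<sqsubseteq>\<^bsub>qhom Q (tp A x) (tp B y)\<^esub> arr B (F x) (F (G y))"
    using adj o G by (force simp: qadjoint_def qfunctor_def)
  moreover have "arr B (F x) (F (G y)) \<sqsubseteq>\<^bsub>qhom Q (tp A x) (tp B y)\<^esub> arr B (F x) y"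
    using B.qcat_le_arr_mono[of "F x" "F x" "F (G y)" y] adj o F G FG B.qcat_le_refl
    by (auto simp: qadjoint_def)
  ultimately show ?thesis
    using o c by (intro A.hom_antisym) (auto intro: A.hom_trans)
qed


section \<open>Fixed points of a distributor\<close>

locale qdistributor = A: qcategory Q A + B: qcategory Q B
  for Q :: "('o, 'a) quantaloid_data"
    and A :: "('x, 'o, 'a) qcat"
    and B :: "('y, 'o, 'a) qcat" +
  fixes \<phi> :: "'x \<times> 'y \<Rightarrow> 'a"
  assumes dist: "\<phi> \<in> carrier (Dist Q A B)"
begin

abbreviation K where "K \<equiv> K_cat Q A B \<phi>"

text \<open>The value at \<open>x\<close> of the presheaf component of \<open>upper_star\<close>
  applied to \<open>p\<close>.\<close>

abbreviation pull :: "'o \<times> ('y \<times> unit \<Rightarrow> 'a) \<Rightarrow> 'x \<Rightarrow> 'a" where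
  "pull p x \<equiv> dcomp Q A B (star Q (fst p)) (snd p) \<phi> (x, ())"

lemma value_closed [simp]:
  "\<lbrakk>x \<in> obs A; y \<in> obs B\<rbrakk> \<Longrightarrow> \<phi> (x, y) \<in> carrier (qhom Q (tp A x) (tp B y))"
  using dist by (rule Dist_value)

lemma K_tp [simp]: "tp K = fst"
  by (simp add: K_cat_def)

lemma K_obs_iff:
  "p \<in> obs K \<longleftrightarrow> p \<in> obs (presheaf_cat Q B) \<and>
    res_sw Q A B (star Q (fst p)) (dcomp Q A B (star Q (fst p)) (snd p) \<phi>) \<phi> = snd p"
  by (cases p) (simp add: K_cat_def lower_star_def upper_star_def)

lemma K_presheaf: "p \<in> obs K \<Longrightarrow> p \<in> obs (presheaf_cat Q B)"
  by (simp add: K_obs_iff)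

lemma K_fst [simp]: "p \<in> obs K \<Longrightarrow> fst p \<in> qob Q"
  by (simp add: K_obs_iff B.presheaf_obs_iff)

lemma K_value [simp]:
  "\<lbrakk>p \<in> obs K; y \<in> obs B\<rbrakk> \<Longrightarrow> snd p (y, ()) \<in> carrier (qhom Q (tp B y) (fst p))"
  by (simp add: K_presheaf)

lemma qcategory_K: "qcategory Q K"
  unfolding K_cat_def
  by (rule qcategory.qcategory_full_subcategory[OF B.qcategory_presheaf]) auto

sublocale K: qcategory Q K
  by (rule qcategory_K)

lemma K_arr: "arr K = arr (presheaf_cat Q B)"
  by (simp add: K_cat_def)

lemma K_arr_closed [simp]:
  "\<lbrakk>p \<in> obs K; q \<in> obs K\<rbrakk> \<Longrightarrow> arr K p q \<in> carrier (qhom Q (fst p) (fst q))"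
  using K.arr_closed[of p q] by simp

lemma K_arr_le_iff:
  assumes "p \<in> obs K" "q \<in> obs K" "f \<in> carrier (qhom Q (fst p) (fst q))"
  shows "f \<sqsubseteq>\<^bsub>qhom Q (fst p) (fst q)\<^esub> arr K p q \<longleftrightarrow>
    (\<forall>y\<in>obs B. qcomp Q (tp B y) (fst p) (fst q) f (snd p (y, ()))
       \<sqsubseteq>\<^bsub>qhom Q (tp B y) (fst q)\<^esub> snd q (y, ()))"
  unfolding K_arr using assms by (intro B.presheaf_arr_le_iff) (simp_all add: K_presheaf)

lemma
  assumes p: "p \<in> obs (presheaf_cat Q B)"
  shows pull_closed: "x \<in> obs A \<Longrightarrow> pull p x \<in> carrier (qhom Q (tp A x) (fst p))"
    and pull_upper: "\<lbrakk>x \<in> obs A; y \<in> obs B\<rbrakk> \<Longrightarrow>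
      qcomp Q (tp A x) (tp B y) (fst p) (snd p (y, ())) (\<phi> (x, y))
        \<sqsubseteq>\<^bsub>qhom Q (tp A x) (fst p)\<^esub> pull p x"
    and pull_least: "\<lbrakk>x \<in> obs A; h \<in> carrier (qhom Q (tp A x) (fst p));
      \<And>y. y \<in> obs B \<Longrightarrow> qcomp Q (tp A x) (tp B y) (fst p) (snd p (y, ())) (\<phi> (x, y))
        \<sqsubseteq>\<^bsub>qhom Q (tp A x) (fst p)\<^esub> h\<rbrakk>
      \<Longrightarrow> pull p x \<sqsubseteq>\<^bsub>qhom Q (tp A x) (fst p)\<^esub> h"
    and comp_pull_le: "\<lbrakk>x \<in> obs A; W \<in> qob Q; g \<in> carrier (qhom Q (fst p) W);
      h \<in> carrier (qhom Q (tp A x) W);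
      \<And>y. y \<in> obs B \<Longrightarrow> qcomp Q (tp A x) (tp B y) W
        (qcomp Q (tp B y) (fst p) W g (snd p (y, ()))) (\<phi> (x, y)) \<sqsubseteq>\<^bsub>qhom Q (tp A x) W\<^esub> h\<rbrakk>
      \<Longrightarrow> qcomp Q (tp A x) (fst p) W g (pull p x) \<sqsubseteq>\<^bsub>qhom Q (tp A x) W\<^esub> h"
    and pull_Dist: "dcomp Q A B (star Q (fst p)) (snd p) \<phi> \<in> carrier (Dist Q A (star Q (fst p)))"
proof -
  have S: "qcategory Q (star Q (fst p))" and D: "snd p \<in> carrier (Dist Q B (star Q (fst p)))"
    using p by (simp_all add: B.presheaf_obs_iff)
  note cx = A.qcategory_axioms B.qcategory_axioms S dist D
  show "x \<in> obs A \<Longrightarrow> pull p x \<in> carrier (qhom Q (tp A x) (fst p))"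
    using dcomp_closed[OF cx, of x "()"] by simp
  show "\<lbrakk>x \<in> obs A; y \<in> obs B\<rbrakk> \<Longrightarrow>
      qcomp Q (tp A x) (tp B y) (fst p) (snd p (y, ())) (\<phi> (x, y))
        \<sqsubseteq>\<^bsub>qhom Q (tp A x) (fst p)\<^esub> pull p x"
    using dcomp_upper[OF cx, of x y "()"] by simp
  show "\<lbrakk>x \<in> obs A; h \<in> carrier (qhom Q (tp A x) (fst p));
      \<And>y. y \<in> obs B \<Longrightarrow> qcomp Q (tp A x) (tp B y) (fst p) (snd p (y, ())) (\<phi> (x, y))
        \<sqsubseteq>\<^bsub>qhom Q (tp A x) (fst p)\<^esub> h\<rbrakk>
      \<Longrightarrow> pull p x \<sqsubseteq>\<^bsub>qhom Q (tp A x) (fst p)\<^esub> h"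
    using dcomp_least[OF cx, of x "()" h] by simp
  show "\<lbrakk>x \<in> obs A; W \<in> qob Q; g \<in> carrier (qhom Q (fst p) W);
      h \<in> carrier (qhom Q (tp A x) W);
      \<And>y. y \<in> obs B \<Longrightarrow> qcomp Q (tp A x) (tp B y) W
        (qcomp Q (tp B y) (fst p) W g (snd p (y, ()))) (\<phi> (x, y)) \<sqsubseteq>\<^bsub>qhom Q (tp A x) W\<^esub> h\<rbrakk>
      \<Longrightarrow> qcomp Q (tp A x) (fst p) W g (pull p x) \<sqsubseteq>\<^bsub>qhom Q (tp A x) W\<^esub> h"
    using comp_dcomp_le[OF cx, of x "()" W g h] by simp
  show "dcomp Q A B (star Q (fst p)) (snd p) \<phi> \<in> carrier (Dist Q A (star Q (fst p)))"
    by (rule dcomp_Dist[OF cx])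
qed

declare pull_closed [OF K_presheaf, simp]

text \<open>A fixed point is the residual of its own pullback along \<phi>, so its value at
  \<open>y\<close> is the largest arrow passing these tests. That the value itself passes them is
  \<open>pull_upper\<close>.\<close>

lemma K_greatest:
  assumes p: "p \<in> obs K" and y: "y \<in> obs B" and d: "d \<in> carrier (qhom Q (tp B y) (fst p))"
    and le: "\<And>x. x \<in> obs A \<Longrightarrow> qcomp Q (tp A x) (tp B y) (fst p) d (\<phi> (x, y))
      \<sqsubseteq>\<^bsub>qhom Q (tp A x) (fst p)\<^esub> pull p x"
  shows "d \<sqsubseteq>\<^bsub>qhom Q (tp B y) (fst p)\<^esub> snd p (y, ())"
  using res_sw_le_iff[OF A.qcategory_axioms B.qcategory_axioms A.qcategory_star dist
      pull_Dist[OF K_presheaf[OF p]], of y "()" d] p y d le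
  by (simp add: K_obs_iff)

text \<open>A presheaf cut out by bounds \<open>c x\<close> is recovered from its pullback, as for
  any image of the right adjoint in a Galois connection. The bounds need not form a presheaf, and
  \<open>S\<close> may vary: the uses below take all of \<open>A\<close> and a single
  object.\<close>

lemma K_I:
  assumes p: "p \<in> obs (presheaf_cat Q B)" and S: "S \<subseteq> obs A"
    and c: "\<And>x. x \<in> S \<Longrightarrow> c x \<in> carrier (qhom Q (tp A x) (fst p))"
    and le_iff: "\<And>y d. \<lbrakk>y \<in> obs B; d \<in> carrier (qhom Q (tp B y) (fst p))\<rbrakk> \<Longrightarrow>
      d \<sqsubseteq>\<^bsub>qhom Q (tp B y) (fst p)\<^esub> snd p (y, ()) \<longleftrightarrow>
      (\<forall>x\<in>S. qcomp Q (tp A x) (tp B y) (fst p) d (\<phi> (x, y)) \<sqsubseteq>\<^bsub>qhom Q (tp A x) (fst p)\<^esub> c x)"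
  shows "p \<in> obs K"
proof -
  let ?r = "res_sw Q A B (star Q (fst p)) (dcomp Q A B (star Q (fst p)) (snd p) \<phi>) \<phi>"
  have X: "fst p \<in> qob Q" and D: "snd p \<in> carrier (Dist Q B (star Q (fst p)))"
    using p by (simp_all add: B.presheaf_obs_iff)
  note r_cats = A.qcategory_axioms B.qcategory_axioms A.qcategory_star[OF X] dist pull_Dist[OF p]
  have r: "?r \<in> carrier (Dist Q B (star Q (fst p)))"
    using res_sw_adjoint[OF A.quantaloid_axioms r_cats] by simp
  have r_le_iff: "d \<sqsubseteq>\<^bsub>qhom Q (tp B y) (fst p)\<^esub> ?r (y, ()) \<longleftrightarrow>
      (\<forall>x\<in>obs A. qcomp Q (tp A x) (tp B y) (fst p) d (\<phi> (x, y))
        \<sqsubseteq>\<^bsub>qhom Q (tp A x) (fst p)\<^esub> pull p x)"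
    if "y \<in> obs B" "d \<in> carrier (qhom Q (tp B y) (fst p))" for y d
    using res_sw_le_iff[OF r_cats, of y "()" d] that by simp
  have "?r = snd p"
  proof (rule Dist_antisym[OF A.quantaloid_axioms B.qcategory_axioms A.qcategory_star[OF X] r D])
    show "?r \<sqsubseteq>\<^bsub>Dist Q B (star Q (fst p))\<^esub> snd p"
      unfolding Dist_le
    proof (intro ballI)
      fix y u assume y: "y \<in> obs B" "u \<in> obs (star Q (fst p))"
      have rv: "?r (y, ()) \<in> carrier (qhom Q (tp B y) (fst p))"
        using Dist_value[OF r y] by simp
      \<comment> \<open>\<open>pull p x\<close> is below \<open>c x\<close>, since every value of
        \<open>p\<close> passes its own test; whatever passes the tests for \<open>pull p\<close>
        therefore passes those for \<open>c\<close>.\<close>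
      have "qcomp Q (tp A x) (tp B y) (fst p) (?r (y, ())) (\<phi> (x, y))
          \<sqsubseteq>\<^bsub>qhom Q (tp A x) (fst p)\<^esub> c x" if x: "x \<in> S" for x
      proof (rule A.hom_trans)
        show "qcomp Q (tp A x) (tp B y) (fst p) (?r (y, ())) (\<phi> (x, y))
          \<sqsubseteq>\<^bsub>qhom Q (tp A x) (fst p)\<^esub> pull p x"
          using r_le_iff[OF y(1) rv] A.hom_refl rv X y x S by auto
        show "pull p x \<sqsubseteq>\<^bsub>qhom Q (tp A x) (fst p)\<^esub> c x"
        proof (rule pull_least[OF p])
          fix y' assume y': "y' \<in> obs B"
          then have "snd p (y', ()) \<sqsubseteq>\<^bsub>qhom Q (tp B y') (fst p)\<^esub> snd p (y', ())"
            using p X by (intro A.hom_refl) auto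
          then show "qcomp Q (tp A x) (tp B y') (fst p) (snd p (y', ())) (\<phi> (x, y'))
              \<sqsubseteq>\<^bsub>qhom Q (tp A x) (fst p)\<^esub> c x"
            using le_iff[OF y', of "snd p (y', ())"] p y' x by simp
        qed (use x S c in auto)
      qed (use X y x S c rv p in \<open>auto intro!: pull_closed A.comp_closed\<close>)
      then show "?r (y, u) \<sqsubseteq>\<^bsub>qhom Q (tp B y) (tp (star Q (fst p)) u)\<^esub> snd p (y, u)"
        using le_iff[OF y(1) rv] by simp
    qed
    \<comment> \<open>The other inequality is the unit of the adjunction between
      \<open>upper_star\<close> and \<open>lower_star\<close>, in the form of
      \<open>pull_upper\<close>.\<close>
    show "snd p \<sqsubseteq>\<^bsub>Dist Q B (star Q (fst p))\<^esub> ?r"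
      using p pull_upper[OF p] by (auto simp: Dist_le r_le_iff)
  qed
  then show ?thesis using p by (simp add: K_obs_iff)
qed

text \<open>The closure \<open>\<phi>\<^sub>* \<phi>\<^sup>*\<close> of the representable presheaf of \<open>y\<close>.\<close>

definition principal :: "'y \<Rightarrow> 'o \<times> ('y \<times> unit \<Rightarrow> 'a)" where
  "principal y = (tp B y,
     res_sw Q A B (star Q (tp B y)) (\<lambda>(x, _) \<in> obs A \<times> {()}. \<phi> (x, y)) \<phi>)"

lemma fst_principal [simp]: "fst (principal y) = tp B y"
  by (simp add: principal_def)

lemma principal_le_iff:
  assumes "y \<in> obs B" "y' \<in> obs B" "d \<in> carrier (qhom Q (tp B y') (tp B y))"
  shows "d \<sqsubseteq>\<^bsub>qhom Q (tp B y') (tp B y)\<^esub> snd (principal y) (y', ()) \<longleftrightarrow>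
    (\<forall>x\<in>obs A. qcomp Q (tp A x) (tp B y') (tp B y) d (\<phi> (x, y'))
      \<sqsubseteq>\<^bsub>qhom Q (tp A x) (tp B y)\<^esub> \<phi> (x, y))"
  using res_sw_le_iff[OF A.qcategory_axioms B.qcategory_axioms A.qcategory_star dist
      Dist_column[OF A.qcategory_axioms B.qcategory_axioms dist], of y y' "()" d] assms
  by (simp add: principal_def)

lemma principal_K [simp]:
  assumes y: "y \<in> obs B"
  shows "principal y \<in> obs K"
proof (rule K_I[where S = "obs A" and c = "\<lambda>x. \<phi> (x, y)"])
  show "principal y \<in> obs (presheaf_cat Q B)"
    using res_sw_adjoint[OF A.quantaloid_axioms A.qcategory_axioms B.qcategory_axioms
      A.qcategory_star dist Dist_column[OF A.qcategory_axioms B.qcategory_axioms dist y]] y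
    by (simp add: B.presheaf_obs_iff principal_def)
qed (use y in \<open>auto simp: principal_le_iff\<close>)

lemma id_le_principal:
  assumes y: "y \<in> obs B"
  shows "qid Q (tp B y) \<sqsubseteq>\<^bsub>qhom Q (tp B y) (tp B y)\<^esub> snd (principal y) (y, ())"
  using y by (auto simp: principal_le_iff intro: A.hom_refl)

text \<open>The identity lies below the value of \<open>principal y\<close> at \<open>y\<close>, so
  \<phi>(x,y) lies below the term of index \<open>y\<close> in the join that forms
  \<open>pull\<close>.\<close>

lemma le_pull_principal:
  assumes o: "x \<in> obs A" "y \<in> obs B"
  shows "\<phi> (x, y) \<sqsubseteq>\<^bsub>qhom Q (tp A x) (tp B y)\<^esub> pull (principal y) x"
proof -
  have "qcomp Q (tp A x) (tp B y) (tp B y) (qid Q (tp B y)) (\<phi> (x, y))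
      \<sqsubseteq>\<^bsub>qhom Q (tp A x) (tp B y)\<^esub> pull (principal y) x"
    by (rule A.comp_le_trans_left[OF _ _ _ _ _ _ _ id_le_principal[OF o(2)]])
      (use o K_value[OF principal_K[OF o(2)] o(2)] pull_closed[OF K_presheaf, of "principal y" x]
        pull_upper[OF K_presheaf, of "principal y" x y] in auto)
  then show ?thesis using o by simp
qed

text \<open>Half of a Yoneda lemma for \<open>K\<close>. A value of \<open>principal y\<close>
  carries \<phi>(x,y') below \<phi>(x,y), so its composite with \<open>d\<close> passes the test of
  \<open>K_greatest\<close> whenever \<open>d\<close> does at \<open>y\<close>.\<close>

lemma le_arr_principal:
  assumes y: "y \<in> obs B" and p: "p \<in> obs K" and d: "d \<in> carrier (qhom Q (tp B y) (fst p))"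
    and le: "d \<sqsubseteq>\<^bsub>qhom Q (tp B y) (fst p)\<^esub> snd p (y, ())"
  shows "d \<sqsubseteq>\<^bsub>qhom Q (tp B y) (fst p)\<^esub> arr K (principal y) p"
proof -
  have "qcomp Q (tp B y') (tp B y) (fst p) d (snd (principal y) (y', ()))
      \<sqsubseteq>\<^bsub>qhom Q (tp B y') (fst p)\<^esub> snd p (y', ())" if y': "y' \<in> obs B" for y'
  proof (rule K_greatest[OF p y'])
    let ?k = "snd (principal y) (y', ())"
    have k: "?k \<in> carrier (qhom Q (tp B y') (tp B y))" using K_value[of "principal y" y'] y y' by simp
    show "qcomp Q (tp B y') (tp B y) (fst p) d ?k \<in> carrier (qhom Q (tp B y') (fst p))"
      using k d y y' p by simp
    fix x assume x: "x \<in> obs A"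
    have 1: "qcomp Q (tp A x) (tp B y') (tp B y) ?k (\<phi> (x, y'))
        \<sqsubseteq>\<^bsub>qhom Q (tp A x) (tp B y)\<^esub> \<phi> (x, y)"
      using principal_le_iff[OF y y' k] A.hom_refl k y y' x by simp
    have 2: "qcomp Q (tp A x) (tp B y) (fst p) d (\<phi> (x, y))
        \<sqsubseteq>\<^bsub>qhom Q (tp A x) (fst p)\<^esub> pull p x"
      by (rule A.comp_le_trans_left[OF _ _ _ _ _ _ _ le pull_upper[OF K_presheaf[OF p] x y]])
        (use x y p d in auto)
    have "qcomp Q (tp A x) (tp B y) (fst p) d (qcomp Q (tp A x) (tp B y') (tp B y) ?k (\<phi> (x, y')))
        \<sqsubseteq>\<^bsub>qhom Q (tp A x) (fst p)\<^esub> pull p x"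
      by (rule A.comp_le_trans_right[OF _ _ _ _ _ _ _ 1 2]) (use x y y' p d k in auto)
    then show "qcomp Q (tp A x) (tp B y') (fst p) (qcomp Q (tp B y') (tp B y) (fst p) d ?k) (\<phi> (x, y'))
        \<sqsubseteq>\<^bsub>qhom Q (tp A x) (fst p)\<^esub> pull p x"
      using x y y' p d k by (simp add: A.comp_assoc)
  qed
  then show ?thesis
    using K_arr_le_iff[OF principal_K[OF y] p] d by simp
qed

text \<open>The presheaf \<open>f \<swarrow> \<phi>(x, -)\<close> of type \<open>Z\<close>.\<close>

definition coprincipal :: "'x \<Rightarrow> 'o \<Rightarrow> 'a \<Rightarrow> 'o \<times> ('y \<times> unit \<Rightarrow> 'a)" where
  "coprincipal x Z f = (Z,
     res_sw Q (star Q (tp A x)) B (star Q Z) (\<lambda>_. f) (\<lambda>(_, y) \<in> {()} \<times> obs B. \<phi> (x, y)))"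

lemma fst_coprincipal [simp]: "fst (coprincipal x Z f) = Z"
  by (simp add: coprincipal_def)

context
  fixes x Z f
  assumes x: "x \<in> obs A" and Z: "Z \<in> qob Q" and f: "f \<in> carrier (qhom Q (tp A x) Z)"
begin

lemma coprincipal_le_iff:
  assumes "y \<in> obs B" "d \<in> carrier (qhom Q (tp B y) Z)"
  shows "d \<sqsubseteq>\<^bsub>qhom Q (tp B y) Z\<^esub> snd (coprincipal x Z f) (y, ()) \<longleftrightarrow>
    qcomp Q (tp A x) (tp B y) Z d (\<phi> (x, y)) \<sqsubseteq>\<^bsub>qhom Q (tp A x) Z\<^esub> f"
  using res_sw_le_iff[OF A.qcategory_star B.qcategory_axioms A.qcategory_star
      Dist_row[OF A.qcategory_axioms B.qcategory_axioms dist x] A.Dist_arrow, of Z f y "()" d]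
    assms x Z f
  by (simp add: coprincipal_def)

text \<open>The criterion \<open>K_I\<close> applies with one object \<open>x\<close> and one bound
  \<open>f\<close>.\<close>

lemma coprincipal_K: "coprincipal x Z f \<in> obs K"
proof (rule K_I[where S = "{x}" and c = "\<lambda>_. f"])
  show "coprincipal x Z f \<in> obs (presheaf_cat Q B)"
    using res_sw_adjoint[OF A.quantaloid_axioms A.qcategory_star B.qcategory_axioms
      A.qcategory_star Dist_row[OF A.qcategory_axioms B.qcategory_axioms dist x]
      A.Dist_arrow, of Z f] x Z f
    by (simp add: B.presheaf_obs_iff coprincipal_def)
qed (use x Z f in \<open>auto simp: coprincipal_le_iff\<close>)

end

section \<open>Evaluation copresheaves on the fixed points\<close>

definition evaluation :: "'x \<Rightarrow> 'o \<times> (unit \<times> ('o \<times> ('y \<times> unit \<Rightarrow> 'a)) \<Rightarrow> 'a)" where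
  "evaluation x = (tp A x, \<lambda>(_, p) \<in> {()} \<times> obs K. pull p x)"

lemma fst_evaluation [simp]: "fst (evaluation x) = tp A x"
  by (simp add: evaluation_def)

lemma snd_evaluation [simp]: "p \<in> obs K \<Longrightarrow> snd (evaluation x) ((), p) = pull p x"
  by (simp add: evaluation_def)

text \<open>Functoriality of pulling back along \<phi>: K(p,q) carries each value of
  \<open>p\<close> below that of \<open>q\<close>, and this survives composition with \<phi> and the
  join. On the source side the star acts by an identity.\<close>

lemma evaluation_copresheaf [simp]:
  assumes x: "x \<in> obs A"
  shows "evaluation x \<in> obs (copresheaf_cat Q K)"
proof -
  have "snd (evaluation x) \<in> carrier (Dist Q (star Q (tp A x)) K)"
  proof (rule DistI_one_sided[OF A.qcategory_star qcategory_K])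
    show "snd (evaluation x) \<in> extensional (obs (star Q (tp A x)) \<times> obs K)"
      by (simp add: evaluation_def)
  next
    fix u p q assume o: "u \<in> obs (star Q (tp A x))" "p \<in> obs K" "q \<in> obs K"
    have "qcomp Q (tp A x) (fst p) (fst q) (arr K p q) (pull p x)
        \<sqsubseteq>\<^bsub>qhom Q (tp A x) (fst q)\<^esub> pull q x"
    proof (rule comp_pull_le[OF K_presheaf])
      fix y assume y: "y \<in> obs B"
      have "qcomp Q (tp B y) (fst p) (fst q) (arr K p q) (snd p (y, ()))
          \<sqsubseteq>\<^bsub>qhom Q (tp B y) (fst q)\<^esub> snd q (y, ())"
        using K_arr_le_iff[of p q "arr K p q"] A.hom_refl o y by simp
      then show "qcomp Q (tp A x) (tp B y) (fst q)
          (qcomp Q (tp B y) (fst p) (fst q) (arr K p q) (snd p (y, ()))) (\<phi> (x, y))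
          \<sqsubseteq>\<^bsub>qhom Q (tp A x) (fst q)\<^esub> pull q x"
        by (rule A.comp_le_trans_left[OF _ _ _ _ _ _ _ _ pull_upper[OF K_presheaf[OF o(3)] x y],
            rotated -1]) (use x y o in auto)
    qed (use x o in auto)
    then show "qcomp Q (tp (star Q (tp A x)) u) (tp K p) (tp K q) (arr K p q)
        (snd (evaluation x) (u, p))
        \<sqsubseteq>\<^bsub>qhom Q (tp (star Q (tp A x)) u) (tp K q)\<^esub> snd (evaluation x) (u, q)"
      using o by simp
  qed (use x A.hom_refl[OF _ _ pull_closed[OF K_presheaf]] in simp_all)
  then show ?thesis using x by (simp add: K.copresheaf_obs_iff)
qed

section \<open>Infima in the category of fixed points\<close>

context
  fixes I
  assumes inf: "qadjoint Q K (copresheaf_cat Q K) (coyoneda K) I"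
begin

lemma
  assumes l: "l \<in> obs (copresheaf_cat Q K)"
  shows inf_K: "I l \<in> obs K" and fst_inf: "fst (I l) = fst l"
  using inf l by (auto simp: qadjoint_def qfunctor_def)

text \<open>The hom-arrow form of the adjunction between \<open>coyoneda K\<close> and
  \<open>I\<close>, with the copresheaf hom-arrow unfolded: the universal property of a limit
  weighted by \<open>l\<close>.\<close>

lemma le_arr_inf_iff:
  assumes l: "l \<in> obs (copresheaf_cat Q K)" and e: "e \<in> obs K"
    and d: "d \<in> carrier (qhom Q (fst e) (fst l))"
  shows "d \<sqsubseteq>\<^bsub>qhom Q (fst e) (fst l)\<^esub> arr K e (I l) \<longleftrightarrow>
    (\<forall>p\<in>obs K. qcomp Q (fst e) (fst l) (fst p) (snd l ((), p)) d
      \<sqsubseteq>\<^bsub>qhom Q (fst e) (fst p)\<^esub> arr K e p)"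
proof -
  have c: "coyoneda K e \<in> obs (copresheaf_cat Q K)" "fst (coyoneda K e) = fst e"
    using inf e by (auto simp: qadjoint_def qfunctor_def)
  have v: "snd (coyoneda K e) ((), p) = arr K e p" if "p \<in> obs K" for p
    using that by (simp add: coyoneda_def)
  have "arr K e (I l) = arr (copresheaf_cat Q K) (coyoneda K e) l"
    using qadjoint_arr_eq[OF qcategory_K K.qcategory_copresheaf inf e l] by simp
  then show ?thesis
    using K.copresheaf_arr_le_iff[OF c(1) l, of d] c d v by simp
qed

text \<open>The universal cone: \<open>le_arr_inf_iff\<close> with \<open>e\<close> the infimum and
  \<open>d\<close> the identity bounds l(p) by K(I l, p), which is then evaluated at
  \<open>y\<close>.\<close>

lemma inf_lower:
  assumes l: "l \<in> obs (copresheaf_cat Q K)" and p: "p \<in> obs K" and y: "y \<in> obs B"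
  shows "qcomp Q (tp B y) (fst l) (fst p) (snd l ((), p)) (snd (I l) (y, ()))
    \<sqsubseteq>\<^bsub>qhom Q (tp B y) (fst p)\<^esub> snd p (y, ())"
proof -
  note I = inf_K[OF l] fst_inf[OF l]
  have t: "fst l \<in> qob Q" using l by (simp add: K.copresheaf_obs_iff)
  have v: "snd l ((), p) \<in> carrier (qhom Q (fst l) (fst p))"
    using K.copresheaf_value[OF l p] by simp
  have "qid Q (fst l) \<sqsubseteq>\<^bsub>qhom Q (fst l) (fst l)\<^esub> arr K (I l) (I l)"
    using K.arr_id[OF I(1)] I by simp
  then have "qcomp Q (fst l) (fst l) (fst p) (snd l ((), p)) (qid Q (fst l))
      \<sqsubseteq>\<^bsub>qhom Q (fst l) (fst p)\<^esub> arr K (I l) p"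
    using le_arr_inf_iff[OF l I(1), of "qid Q (fst l)"] p t I by simp
  then have "snd l ((), p) \<sqsubseteq>\<^bsub>qhom Q (fst l) (fst p)\<^esub> arr K (I l) p"
    using p t v by simp
  then show ?thesis
    using K_arr_le_iff[OF I(1) p, of "snd l ((), p)"] v I y by simp
qed

text \<open>The universal property mentions only objects of \<open>K\<close>, so \<open>y\<close>
  enters as \<open>principal y\<close>: \<open>le_arr_principal\<close> lifts the hypothesis, and
  \<open>id_le_principal\<close> brings the conclusion back. Together with \<open>inf_lower\<close>
  this computes infima pointwise over \<open>B\<close>.\<close>

lemma inf_greatest:
  assumes l: "l \<in> obs (copresheaf_cat Q K)" and y: "y \<in> obs B"
    and d: "d \<in> carrier (qhom Q (tp B y) (fst l))"
    and le: "\<And>p. p \<in> obs K \<Longrightarrow> qcomp Q (tp B y) (fst l) (fst p) (snd l ((), p)) d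
      \<sqsubseteq>\<^bsub>qhom Q (tp B y) (fst p)\<^esub> snd p (y, ())"
  shows "d \<sqsubseteq>\<^bsub>qhom Q (tp B y) (fst l)\<^esub> snd (I l) (y, ())"
proof -
  note I = inf_K[OF l] fst_inf[OF l]
  have t: "fst l \<in> qob Q" using l by (simp add: K.copresheaf_obs_iff)
  have v: "snd (I l) (y, ()) \<in> carrier (qhom Q (tp B y) (fst l))"
    using K_value[OF I(1) y] I by simp
  have k: "snd (principal y) (y, ()) \<in> carrier (qhom Q (tp B y) (tp B y))"
    using K_value[of "principal y" y] y by simp
  have "qcomp Q (tp B y) (fst l) (fst p) (snd l ((), p)) d
      \<sqsubseteq>\<^bsub>qhom Q (tp B y) (fst p)\<^esub> arr K (principal y) p" if p: "p \<in> obs K" for p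
    using le_arr_principal[OF y p _ le[OF p]] K.copresheaf_value[OF l p] p y d t by simp
  then have "d \<sqsubseteq>\<^bsub>qhom Q (tp B y) (fst l)\<^esub> arr K (principal y) (I l)"
    using le_arr_inf_iff[OF l principal_K[OF y], of d] d by simp
  then have 1: "qcomp Q (tp B y) (tp B y) (fst l) d (snd (principal y) (y, ()))
      \<sqsubseteq>\<^bsub>qhom Q (tp B y) (fst l)\<^esub> snd (I l) (y, ())"
    using K_arr_le_iff[OF principal_K[OF y] I(1), of d] d I y by simp
  have "qcomp Q (tp B y) (tp B y) (fst l) d (qid Q (tp B y))
      \<sqsubseteq>\<^bsub>qhom Q (tp B y) (fst l)\<^esub> snd (I l) (y, ())"
    by (rule A.comp_le_trans_right[OF _ _ _ _ _ _ _ id_le_principal[OF y] 1])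
      (use y t d v k in auto)
  then show ?thesis using y t d by simp
qed

section \<open>The quasi-inverse and its two inequalities\<close>

definition quasi_inverse :: "'y \<times> 'x \<Rightarrow> 'a" where
  "quasi_inverse = (\<lambda>(y, x) \<in> obs B \<times> obs A. snd (I (evaluation x)) (y, ()))"

lemma quasi_inverse_eq:
  "\<lbrakk>y \<in> obs B; x \<in> obs A\<rbrakk> \<Longrightarrow> quasi_inverse (y, x) = snd (I (evaluation x)) (y, ())"
  by (simp add: quasi_inverse_def)

lemma quasi_inverse_closed [simp]:
  assumes "y \<in> obs B" "x \<in> obs A"
  shows "quasi_inverse (y, x) \<in> carrier (qhom Q (tp B y) (tp A x))"
  using K_value[OF inf_K[OF evaluation_copresheaf] assms(1), of x] assms fst_inf
  by (simp add: quasi_inverse_eq)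

lemma pull_quasi_inverse_le:
  assumes "p \<in> obs K" "y \<in> obs B" "x \<in> obs A"
  shows "qcomp Q (tp B y) (tp A x) (fst p) (pull p x) (quasi_inverse (y, x))
    \<sqsubseteq>\<^bsub>qhom Q (tp B y) (fst p)\<^esub> snd p (y, ())"
  using inf_lower[OF evaluation_copresheaf, of x p y] assms by (simp add: quasi_inverse_eq)

lemma quasi_inverse_Dist: "quasi_inverse \<in> carrier (Dist Q B A)"
proof (rule DistI_one_sided[OF B.qcategory_axioms A.qcategory_axioms])
  show "quasi_inverse \<in> extensional (obs B \<times> obs A)"
    by (simp add: quasi_inverse_def)
next
  fix y y' x assume o: "y \<in> obs B" "y' \<in> obs B" "x \<in> obs A"
  \<comment> \<open>In the first variable \<open>quasi_inverse\<close> is the presheaf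
    \<open>I (evaluation x)\<close>.\<close>
  have "snd (I (evaluation x)) \<in> carrier (Dist Q B (star Q (tp A x)))"
    using K_presheaf[OF inf_K[OF evaluation_copresheaf[OF o(3)]]] o fst_inf
    by (simp add: B.presheaf_obs_iff)
  from Dist_pre[OF B.qcategory_axioms A.qcategory_star this o(1,2), of "()"]
  show "qcomp Q (tp B y') (tp B y) (tp A x) (quasi_inverse (y, x)) (arr B y' y)
      \<sqsubseteq>\<^bsub>qhom Q (tp B y') (tp A x)\<^esub> quasi_inverse (y', x)"
    using o by (simp add: quasi_inverse_eq)
next
  fix y x x' assume o: "y \<in> obs B" "x \<in> obs A" "x' \<in> obs A"
  let ?d = "qcomp Q (tp B y) (tp A x) (tp A x') (arr A x x') (quasi_inverse (y, x))"
  \<comment> \<open>In the second variable, maximality of the infimum reduces the claim to a test at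
    each fixed point \<open>p\<close>, where A(x,x') is absorbed because \<open>pull p\<close> comes
    from a presheaf on \<open>A\<close>.\<close>
  have "?d \<sqsubseteq>\<^bsub>qhom Q (tp B y) (fst (evaluation x'))\<^esub> snd (I (evaluation x')) (y, ())"
  proof (rule inf_greatest)
    fix p assume p: "p \<in> obs K"
    have 1: "qcomp Q (tp A x) (tp A x') (fst p) (pull p x') (arr A x x')
        \<sqsubseteq>\<^bsub>qhom Q (tp A x) (fst p)\<^esub> pull p x"
      using Dist_pre[OF A.qcategory_axioms A.qcategory_star pull_Dist[OF K_presheaf[OF p]] o(3,2),
        of "()"] p by simp
    have "qcomp Q (tp B y) (tp A x) (fst p)
        (qcomp Q (tp A x) (tp A x') (fst p) (pull p x') (arr A x x')) (quasi_inverse (y, x))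
        \<sqsubseteq>\<^bsub>qhom Q (tp B y) (fst p)\<^esub> snd p (y, ())"
      by (rule A.comp_le_trans_left[OF _ _ _ _ _ _ _ 1 pull_quasi_inverse_le[OF p o(1,2)]])
        (use p o in auto)
    then show "qcomp Q (tp B y) (fst (evaluation x')) (fst p) (snd (evaluation x') ((), p)) ?d
        \<sqsubseteq>\<^bsub>qhom Q (tp B y) (fst p)\<^esub> snd p (y, ())"
      using p o by (simp add: A.comp_assoc)
  qed (use o in auto)
  then show "?d \<sqsubseteq>\<^bsub>qhom Q (tp B y) (tp A x')\<^esub> quasi_inverse (y, x')"
    using o by (simp add: quasi_inverse_eq)
qed simp

text \<open>The bound \<open>pull_quasi_inverse_le\<close> is tested at \<open>principal y\<close>.
  Since \<phi>(x',y) is below its pullback at x', the inner composite is below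
  \<open>principal y\<close> at y', and \<open>principal_le_iff\<close> turns this into the
  claim.\<close>

lemma quasi_inverse_le:
  assumes o: "x \<in> obs A" "x' \<in> obs A" "y \<in> obs B" "y' \<in> obs B"
  shows "qcomp Q (tp A x) (tp B y') (tp B y)
      (qcomp Q (tp B y') (tp A x') (tp B y) (\<phi> (x', y)) (quasi_inverse (y', x'))) (\<phi> (x, y'))
    \<sqsubseteq>\<^bsub>qhom Q (tp A x) (tp B y)\<^esub> \<phi> (x, y)"
proof -
  have k: "snd (principal y) (y', ()) \<in> carrier (qhom Q (tp B y') (tp B y))"
    and pk: "pull (principal y) x' \<in> carrier (qhom Q (tp A x') (tp B y))"
    using K_value[OF principal_K[OF o(3)] o(4)]
      pull_closed[OF K_presheaf[OF principal_K[OF o(3)]] o(2)] by auto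
  have "qcomp Q (tp B y') (tp A x') (tp B y) (\<phi> (x', y)) (quasi_inverse (y', x'))
      \<sqsubseteq>\<^bsub>qhom Q (tp B y') (tp B y)\<^esub> snd (principal y) (y', ())"
    by (rule A.comp_le_trans_left[OF _ _ _ _ _ _ _
          le_pull_principal[OF o(2,3), unfolded fst_principal]
          pull_quasi_inverse_le[OF principal_K[OF o(3)] o(4,2), unfolded fst_principal]])
      (use o k pk in auto)
  then show ?thesis using principal_le_iff[OF o(3,4)] o by simp
qed

text \<open>The right adjoint \<open>R\<close> enters here. The test object \<open>m\<close>
  collects the arrows that carry \<phi>(x,-) below \<open>f\<close>, so the goal amounts to the
  identity lying below m(y).\<close>

lemma le_comp_quasi_inverse:
  assumes R: "qadjoint Q (copresheaf_cat Q K) K I R" and o: "x \<in> obs A" "y \<in> obs B"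
  shows "\<phi> (x, y) \<sqsubseteq>\<^bsub>qhom Q (tp A x) (tp B y)\<^esub>
    dcomp Q A A B \<phi> (dcomp Q A B A quasi_inverse \<phi>) (x, y)"
proof -
  note cA = A.qcategory_axioms and cB = B.qcategory_axioms
  note D1 = dcomp_Dist[OF cA cB cA dist quasi_inverse_Dist]
  define f where "f = dcomp Q A A B \<phi> (dcomp Q A B A quasi_inverse \<phi>) (x, y)"
  have f: "f \<in> carrier (qhom Q (tp A x) (tp B y))"
    unfolding f_def by (rule dcomp_closed[OF cA cA cB D1 dist o])
  define m where "m = coprincipal x (tp B y) f"
  have m: "m \<in> obs K" "fst m = tp B y"
    unfolding m_def using coprincipal_K o f by auto
  have m_le_iff: "d \<sqsubseteq>\<^bsub>qhom Q (tp B b) (tp B y)\<^esub> snd m (b, ()) \<longleftrightarrow>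
      qcomp Q (tp A x) (tp B b) (tp B y) d (\<phi> (x, b)) \<sqsubseteq>\<^bsub>qhom Q (tp A x) (tp B y)\<^esub> f"
    if "b \<in> obs B" "d \<in> carrier (qhom Q (tp B b) (tp B y))" for b d
    unfolding m_def using coprincipal_le_iff[OF o(1) _ f] that o by simp
  have Rm: "R m \<in> obs (copresheaf_cat Q K)" "fst (R m) = tp B y"
    using R m by (auto simp: qadjoint_def qfunctor_def)
  have Rv: "snd (R m) ((), p) \<in> carrier (qhom Q (tp B y) (fst p))" if "p \<in> obs K" for p
    using K.copresheaf_value[OF Rm(1) that] Rm by simp
  have I_R: "arr K (I l) m = arr (copresheaf_cat Q K) l (R m)"
    if "l \<in> obs (copresheaf_cat Q K)" for l
    by (rule qadjoint_arr_eq[OF K.qcategory_copresheaf qcategory_K R that m(1)])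
  have le_pull: "qcomp Q (tp A a) (tp B y) (fst p) (snd (R m) ((), p)) (\<phi> (a, y))
      \<sqsubseteq>\<^bsub>qhom Q (tp A a) (fst p)\<^esub> pull p a" if a: "a \<in> obs A" and p: "p \<in> obs K" for a p
  proof -
    have e: "I (evaluation a) \<in> obs K" "fst (I (evaluation a)) = tp A a"
      using inf_K fst_inf a by simp_all
    \<comment> \<open>Through \<open>m_le_iff\<close> this says that \<phi>(a,y) o \<psi>(b,a) o
      \<phi>(x,b) <= f, where \<psi> is the quasi-inverse; the left side is one term of the double
      join \<open>f\<close>.\<close>
    have "qcomp Q (tp B b) (tp A a) (tp B y) (\<phi> (a, y)) (snd (I (evaluation a)) (b, ()))
        \<sqsubseteq>\<^bsub>qhom Q (tp B b) (tp B y)\<^esub> snd m (b, ())" if b: "b \<in> obs B" for b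
    proof -
      have "qcomp Q (tp A x) (tp A a) (tp B y) (\<phi> (a, y))
          (qcomp Q (tp A x) (tp B b) (tp A a) (quasi_inverse (b, a)) (\<phi> (x, b)))
          \<sqsubseteq>\<^bsub>qhom Q (tp A x) (tp B y)\<^esub> f"
        unfolding f_def
        by (rule A.comp_le_trans_right[OF _ _ _ _ _ _ _
              dcomp_upper[OF cA cB cA dist quasi_inverse_Dist o(1) b a]
              dcomp_upper[OF cA cA cB D1 dist o(1) a o(2)]])
          (use o a b f dcomp_closed[OF cA cB cA dist quasi_inverse_Dist o(1) a] in
            \<open>auto simp: f_def\<close>)
      then show ?thesis
        using m_le_iff[OF b] o a b quasi_inverse_closed[OF b a]
        by (simp add: quasi_inverse_eq A.comp_assoc)
    qed
    then have "\<phi> (a, y) \<sqsubseteq>\<^bsub>qhom Q (tp A a) (tp B y)\<^esub> arr K (I (evaluation a)) m"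
      using K_arr_le_iff[OF e(1) m(1), of "\<phi> (a, y)"] e m a o by simp
    \<comment> \<open>Transposed by \<open>I_R\<close>, the inequality bounds \<phi>(a,y) by the
      hom-arrow from \<open>evaluation a\<close> to \<open>R m\<close>, and its test at
      \<open>p\<close> is the claim.\<close>
    then show ?thesis
      using K.copresheaf_arr_le_iff[OF evaluation_copresheaf[OF a] Rm(1), of "\<phi> (a, y)"]
        I_R[OF evaluation_copresheaf[OF a]] Rm a p o by simp
  qed
  \<comment> \<open>With \<open>a\<close> ranging over \<open>A\<close>, \<open>le_pull\<close> is
    the family of tests that determines the fixed point \<open>p\<close> at
    \<open>y\<close>.\<close>
  have "snd (R m) ((), p) \<sqsubseteq>\<^bsub>qhom Q (tp B y) (fst p)\<^esub> snd p (y, ())" if p: "p \<in> obs K" for p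
    by (rule K_greatest[OF p o(2) Rv[OF p] le_pull[OF _ p]])
  \<comment> \<open>All components of \<open>R m\<close> satisfy this bound, so the identity is a
    candidate in \<open>inf_greatest\<close>.\<close>
  then have 1: "qid Q (tp B y) \<sqsubseteq>\<^bsub>qhom Q (tp B y) (tp B y)\<^esub> snd (I (R m)) (y, ())"
    using inf_greatest[OF Rm(1) o(2), of "qid Q (tp B y)"] Rm Rv o by simp
  note IR = inf_K[OF Rm(1)] fst_inf[OF Rm(1)]
  \<comment> \<open>The counit at \<open>m\<close>, obtained by transposing the identity bound on
    the hom-arrow of \<open>R m\<close> with itself.\<close>
  have "qid Q (tp B y) \<sqsubseteq>\<^bsub>qhom Q (tp B y) (tp B y)\<^esub> arr K (I (R m)) m"
    using qcategory.arr_id[OF K.qcategory_copresheaf Rm(1)] I_R[OF Rm(1)] Rm by simp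
  then have 2: "qcomp Q (tp B y) (tp B y) (tp B y) (qid Q (tp B y)) (snd (I (R m)) (y, ()))
      \<sqsubseteq>\<^bsub>qhom Q (tp B y) (tp B y)\<^esub> snd m (y, ())"
    using K_arr_le_iff[OF IR(1) m(1), of "qid Q (tp B y)"] IR m Rm o by simp
  have "snd (I (R m)) (y, ()) \<in> carrier (qhom Q (tp B y) (tp B y))"
    "snd m (y, ()) \<in> carrier (qhom Q (tp B y) (tp B y))"
    using K_value[OF IR(1) o(2)] K_value[OF m(1) o(2)] IR Rm m by auto
  then have "qid Q (tp B y) \<sqsubseteq>\<^bsub>qhom Q (tp B y) (tp B y)\<^esub> snd m (y, ())"
    using 1 2 o by (auto intro: A.hom_trans)
  \<comment> \<open>For the identity, \<open>m_le_iff\<close> reads \<phi>(x,y) <= f.\<close>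
  then show ?thesis using m_le_iff[OF o(2)] o by (simp add: f_def)
qed

end

end

section \<open>The two inequalities assembled into regularity of \<phi>\<close>

theorem theorem6p3:
  fixes Q :: "('o, 'a) quantaloid_data"
    and A :: "('x, 'o, 'a) qcat"
    and B :: "('y, 'o, 'a) qcat"
    and \<phi> :: "'x \<times> 'y \<Rightarrow> 'a"
  assumes "quantaloid Q"
    and "qcategory Q A"
    and "qcategory Q B"
    and "\<phi> \<in> carrier (Dist Q A B)"
    and "op_ccd Q (K_cat Q A B \<phi>)"
  shows "regular_dist Q A B \<phi>"
proof -
  interpret qdistributor Q A B \<phi>
    using assms by (intro qdistributor.intro qdistributor_axioms.intro)
  obtain I R where I: "qadjoint Q K (copresheaf_cat Q K) (coyoneda K) I"
    and R: "qadjoint Q (copresheaf_cat Q K) K I R"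
    using assms(5) unfolding op_ccd_def by blast
  let ?\<psi> = "quasi_inverse I"
  note cA = assms(2) and cB = assms(3)
  note \<psi> = quasi_inverse_Dist[OF I]
  note D1 = dcomp_Dist[OF cA cB cA dist \<psi>]
  note D2 = dcomp_Dist[OF cA cA cB D1 dist]
  have "dcomp Q A A B \<phi> (dcomp Q A B A ?\<psi> \<phi>) = \<phi>"
  proof (rule Dist_antisym[OF assms(1-3) D2 dist])
    show "dcomp Q A A B \<phi> (dcomp Q A B A ?\<psi> \<phi>) \<sqsubseteq>\<^bsub>Dist Q A B\<^esub> \<phi>"
      \<comment> \<open>\<open>dcomp_le_iff\<close> removes the outer join and
        \<open>comp_dcomp_le\<close> the inner one, leaving the termwise bound
        \<open>quasi_inverse_le\<close>.\<close>
      unfolding dcomp_le_iff[OF assms(1) cA cA cB dist D1 dist]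
      by (auto intro!: comp_dcomp_le[OF cA cB cA dist \<psi>] quasi_inverse_le[OF I])
    show "\<phi> \<sqsubseteq>\<^bsub>Dist Q A B\<^esub> dcomp Q A A B \<phi> (dcomp Q A B A ?\<psi> \<phi>)"
      using le_comp_quasi_inverse[OF I R] by (simp add: Dist_le)
  qed
  then show ?thesis using \<psi> by (auto simp: regular_dist_def)
qed

end
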